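(* Let $1\leq p\leq\infty$. Let $\mathcal D=\mathcal S(\mathbb R)$ be the Schwartz space of rapidly decreasing functions on $\mathbb R$. Let $T=\frac{d^2}{dt^2}-t^2$ be the Hermite operator, and view $T$ as an operator on $L^p(\mathbb R,dt)$ with domain $\mathcal D$. Let $T_c$ be its maximal (distributional) extension on $L^p(\mathbb R,dt)$ (defined in the context), and let $T_e$ be a linear operator on $L^p(\mathbb R,dt)$ with $T\subset T_e\subset T_c$. Then $T_e$ has the single-valued extension property. Let $f\in\mathcal D$, and let $\mathcal Ff:\mathbb N_0\to\mathbb C$, $\mathcal Ff(n)=\int_{\mathbb R}f(t)h_n(t)\,dt$, be the Hermite transform of $f$, where $h_n$ is the normalised Hermite function of order $n$. Then the following limit exists in the extended positive real numbers $[0,\infty]$ and $$\lim_{n\to\infty}\|T_e^nf\|_p^{1/n}=\sup\left\{|z| : z\in\{-(2n+1) : n\in\mathbb N_0,\ \mathcal Ff(n)\neq0\}\right\}.$$ Moreover, $$\sigma_{T_e}(f)=\{-(2n+1) : n\in\mathbb N_0,\ \mathcal Ff(n)\neq0\},$$ so that the former equality is a local spectral radius formula $\lim_{n\to\infty}\|T_e^nf\|_p^{1/n}=\sup\{|z| : z\in\sigma_{T_e}(f)\}$ for $T_e$ at $f$.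
   Context: $\mathbb N_0=\{0,1,2,\ldots\}$; $\sup\emptyset=0$. For $n\in\mathbb N_0$ and $t\in\mathbb R$, $$h_n(t)=(-1)^n(2^nn!\sqrt\pi)^{-1/2}e^{\frac12t^2}\frac{d^n}{dt^n}e^{-t^2}.$$ $T_c$ is the operator on $L^p(\mathbb R,dt)$ whose domain consists of all $f\in L^p(\mathbb R,dt)$ for which the tempered distribution $Tf$ is in $L^p(\mathbb R,dt)$, i.e. for which there is $h\in L^p(\mathbb R,dt)$ (necessarily unique) with $\int_{\mathbb R}h\,g\,dt=\int_{\mathbb R}f\,(Tg)\,dt$ for all $g\in\mathcal S(\mathbb R)$; then $T_cf=h$. For operators, $A\subset B$ means that $B$ extends $A$. For a linear operator $S$ on a complex Banach space $X$ with domain $\mathcal D(S)\subset X$: $S$ has the single-valued extension property if, for every non-empty open $U\subset\mathbb C$, the only analytic $\phi:U\to\mathcal D(S)$ with $(S-z)\phi_z=0$ for all $z\in U$ is zero. For $x\in X$, $z_0\in\mathbb C$ is in the local resolvent set $\rho_S(x)$ if there are an open neighborhood $U$ of $z_0$ and an analytic $\phi:U\to\mathcal D(S)$ with $(S-z)\phi_z=x$ for all $z\in U$; the local spectrum is $\sigma_S(x)=\mathbb C\setminus\rho_S(x)$. Analyticity is with respect to the norm of $X$ (an analytic $X$-valued function with values in $\mathcal D(S)$). *)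

theory Defs
  imports "HOL-Probability.Essential_Supremum"
begin

section \<open>Measurable functions modulo equality almost everywhere\<close>

quotient_type aefun = "real \<Rightarrow> complex" / partial:
  "\<lambda>f g. f \<in> borel_measurable borel \<and> g \<in> borel_measurable borel \<and> (AE t in lborel. f t = g t)"
  morphisms fun_of aeclass
proof (rule part_equivpI)
  show "\<exists>f :: real \<Rightarrow> complex. f \<in> borel_measurable borel \<and> f \<in> borel_measurable borel \<and>
      (AE t in lborel. f t = f t)"
    by (rule exI[of _ "\<lambda>_. 0"]) simp
qed (auto simp: symp_def transp_def)

instantiation aefun :: ab_group_add
begin

lift_definition zero_aefun :: aefun is "\<lambda>_. 0" by simp

lift_definition plus_aefun :: "aefun \<Rightarrow> aefun \<Rightarrow> aefun" is "\<lambda>f g t. f t + g t" by auto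

lift_definition uminus_aefun :: "aefun \<Rightarrow> aefun" is "\<lambda>f t. - f t" by auto

lift_definition minus_aefun :: "aefun \<Rightarrow> aefun \<Rightarrow> aefun" is "\<lambda>f g t. f t - g t" by auto

instance
  by standard (transfer; auto simp: algebra_simps)+

end

lift_definition scale_ae :: "complex \<Rightarrow> aefun \<Rightarrow> aefun"  (infixr "*\<^sub>a" 75)
  is "\<lambda>c f t. c * f t" by auto

lemma vector_space_aefun: "vector_space (*\<^sub>a)"
  by standard (transfer; auto simp: algebra_simps)+

lemma fun_of_measurable: "fun_of u \<in> borel_measurable borel"
  using Quotient_rep_reflp[OF Quotient_aefun, of u] by (simp add: cr_aefun_def)

lemma fun_of_aeclass:
  assumes "f \<in> borel_measurable borel"
  shows "AE t in lborel. fun_of (aeclass f) t = f t"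
  using Quotient3_rep_abs[OF Quotient3_aefun, of f] assms by simp

lemma aefun_eq_iff: "u = v \<longleftrightarrow> (AE t in lborel. fun_of u t = fun_of v t)"
  using Quotient3_rel_rep[OF Quotient3_aefun, of u v] fun_of_measurable by auto


section \<open>The spaces \<open>L\<^sup>p(\<real>)\<close>\<close>

lemma esssup_norm_cong_AE:
  fixes f g :: "real \<Rightarrow> complex"
  assumes "f \<in> borel_measurable borel" "g \<in> borel_measurable borel" "AE t in lborel. f t = g t"
  shows "esssup lborel (\<lambda>t. ennreal (norm (f t))) = esssup lborel (\<lambda>t. ennreal (norm (g t)))"
proof -
  have [measurable]: "f \<in> borel_measurable borel" "g \<in> borel_measurable borel" using assms by auto
  have "(AE t in lborel. ennreal (norm (f t)) \<le> z) = (AE t in lborel. ennreal (norm (g t)) \<le> z)" for z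
    using eventually_cong[OF assms(3), of "\<lambda>t. ennreal (norm (f t)) \<le> z" "\<lambda>t. ennreal (norm (g t)) \<le> z"] by simp
  then show ?thesis by (simp add: esssup_eq_AE)
qed

lift_definition in_Lp :: "ennreal \<Rightarrow> aefun \<Rightarrow> bool" is
  "\<lambda>p f. if p = \<infinity> then esssup lborel (\<lambda>t. ennreal (norm (f t))) < \<infinity>
         else integrable lborel (\<lambda>t. norm (f t) powr enn2real p)"
proof -
  fix p :: ennreal and f g :: "real \<Rightarrow> complex"
  assume *: "f \<in> borel_measurable borel \<and> g \<in> borel_measurable borel \<and> (AE t in lborel. f t = g t)"
  then have [measurable]: "f \<in> borel_measurable borel" "g \<in> borel_measurable borel" by auto
  have "esssup lborel (\<lambda>t. ennreal (norm (f t))) = esssup lborel (\<lambda>t. ennreal (norm (g t)))"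
    using * by (intro esssup_norm_cong_AE) auto
  moreover have "integrable lborel (\<lambda>t. norm (f t) powr enn2real p) =
      integrable lborel (\<lambda>t. norm (g t) powr enn2real p)"
    using * by (intro integrable_cong_AE) auto
  ultimately show "(if p = \<infinity> then esssup lborel (\<lambda>t. ennreal (norm (f t))) < \<infinity>
         else integrable lborel (\<lambda>t. norm (f t) powr enn2real p)) =
    (if p = \<infinity> then esssup lborel (\<lambda>t. ennreal (norm (g t))) < \<infinity>
         else integrable lborel (\<lambda>t. norm (g t) powr enn2real p))"
    by simp
qed

definition Lp :: "ennreal \<Rightarrow> aefun set" where
  "Lp p = {u. in_Lp p u}"

text \<open>Only meaningful on \<^term>\<open>Lp p\<close>; elsewhere the value is a default.\<close>

lift_definition Lp_norm :: "ennreal \<Rightarrow> aefun \<Rightarrow> real" is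
  "\<lambda>p f. if p = \<infinity> then enn2real (esssup lborel (\<lambda>t. ennreal (norm (f t))))
         else (LINT t|lborel. norm (f t) powr enn2real p) powr (1 / enn2real p)"
proof -
  fix p :: ennreal and f g :: "real \<Rightarrow> complex"
  assume *: "f \<in> borel_measurable borel \<and> g \<in> borel_measurable borel \<and> (AE t in lborel. f t = g t)"
  then have [measurable]: "f \<in> borel_measurable borel" "g \<in> borel_measurable borel" by auto
  have "esssup lborel (\<lambda>t. ennreal (norm (f t))) = esssup lborel (\<lambda>t. ennreal (norm (g t)))"
    using * by (intro esssup_norm_cong_AE) auto
  moreover have "(LINT t|lborel. norm (f t) powr enn2real p) =
      (LINT t|lborel. norm (g t) powr enn2real p)"
    using * by (intro integral_cong_AE) auto
  ultimately show "(if p = \<infinity> then enn2real (esssup lborel (\<lambda>t. ennreal (norm (f t))))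
         else (LINT t|lborel. norm (f t) powr enn2real p) powr (1 / enn2real p)) =
    (if p = \<infinity> then enn2real (esssup lborel (\<lambda>t. ennreal (norm (g t))))
         else (LINT t|lborel. norm (g t) powr enn2real p) powr (1 / enn2real p))"
    by simp
qed


section \<open>Linear operators and local spectral theory in \<open>L\<^sup>p(\<real>)\<close>\<close>

text \<open>
  A linear operator is represented by its graph. Its domain is then \<^const>\<open>Domain\<close>, extension
  of operators is inclusion of graphs, and \<open>S ^^ n\<close> (composition of relations) is the \<open>n\<close>-th
  power of \<open>S\<close> on its natural domain.
\<close>

definition linear_operator :: "ennreal \<Rightarrow> (aefun \<times> aefun) set \<Rightarrow> bool" where
  "linear_operator p S \<longleftrightarrow>
     S \<subseteq> Lp p \<times> Lp p \<and> single_valued S \<and> (0, 0) \<in> S \<and>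
     (\<forall>x y x' y'. (x, y) \<in> S \<longrightarrow> (x', y') \<in> S \<longrightarrow> (x + x', y + y') \<in> S) \<and>
     (\<forall>c x y. (x, y) \<in> S \<longrightarrow> (c *\<^sub>a x, c *\<^sub>a y) \<in> S)"

definition op_apply :: "(aefun \<times> aefun) set \<Rightarrow> aefun \<Rightarrow> aefun" where
  "op_apply S x = (THE y. (x, y) \<in> S)"

text \<open>Complex differentiability in the \<open>L\<^sup>p\<close>-norm at every point of \<open>U\<close>; only used for open \<open>U\<close>.\<close>

definition analytic_Lp :: "ennreal \<Rightarrow> (complex \<Rightarrow> aefun) \<Rightarrow> complex set \<Rightarrow> bool" where
  "analytic_Lp p \<phi> U \<longleftrightarrow>
     (\<forall>z\<in>U. \<phi> z \<in> Lp p) \<and>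
     (\<forall>z\<in>U. \<exists>d\<in>Lp p.
        ((\<lambda>w. Lp_norm p (inverse (w - z) *\<^sub>a (\<phi> w - \<phi> z) - d)) \<longlongrightarrow> 0) (at z))"

definition has_svep :: "ennreal \<Rightarrow> (aefun \<times> aefun) set \<Rightarrow> bool" where
  "has_svep p S \<longleftrightarrow>
     (\<forall>U \<phi>. open U \<and> U \<noteq> {} \<and> analytic_Lp p \<phi> U \<and>
        (\<forall>z\<in>U. \<phi> z \<in> Domain S \<and> op_apply S (\<phi> z) - z *\<^sub>a \<phi> z = 0) \<longrightarrow>
        (\<forall>z\<in>U. \<phi> z = 0))"

definition local_resolvent_set :: "ennreal \<Rightarrow> (aefun \<times> aefun) set \<Rightarrow> aefun \<Rightarrow> complex set" where
  "local_resolvent_set p S x =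
     {z\<^sub>0. \<exists>U \<phi>. open U \<and> z\<^sub>0 \<in> U \<and> analytic_Lp p \<phi> U \<and>
        (\<forall>z\<in>U. \<phi> z \<in> Domain S \<and> op_apply S (\<phi> z) - z *\<^sub>a \<phi> z = x)}"

definition local_spectrum :: "ennreal \<Rightarrow> (aefun \<times> aefun) set \<Rightarrow> aefun \<Rightarrow> complex set" where
  "local_spectrum p S x = UNIV - local_resolvent_set p S x"


section \<open>Schwartz functions and the Hermite operator\<close>

definition nth_vderiv :: "nat \<Rightarrow> (real \<Rightarrow> complex) \<Rightarrow> real \<Rightarrow> complex" where
  "nth_vderiv n = (\<lambda>f t. vector_derivative f (at t)) ^^ n"

definition schwartz_space :: "(real \<Rightarrow> complex) set" where
  "schwartz_space =
     {f. (\<forall>n t. nth_vderiv n f differentiable (at t)) \<and>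
         (\<forall>m n. \<exists>C. \<forall>t. \<bar>t\<bar> ^ m * norm (nth_vderiv n f t) \<le> C)}"

definition hermite_diff :: "(real \<Rightarrow> complex) \<Rightarrow> real \<Rightarrow> complex" where
  "hermite_diff f t = nth_vderiv 2 f t - of_real (t\<^sup>2) * f t"

definition hermite_operator :: "(aefun \<times> aefun) set" where
  "hermite_operator = {(aeclass f, aeclass (hermite_diff f)) | f. f \<in> schwartz_space}"

definition maximal_hermite_operator :: "ennreal \<Rightarrow> (aefun \<times> aefun) set" where
  "maximal_hermite_operator p =
     {(u, h). u \<in> Lp p \<and> h \<in> Lp p \<and>
        (\<forall>g\<in>schwartz_space.
           (LINT t|lborel. fun_of h t * g t) = (LINT t|lborel. fun_of u t * hermite_diff g t))}"

definition hermite_function :: "nat \<Rightarrow> real \<Rightarrow> real" where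
  "hermite_function n t =
     (-1) ^ n * (2 ^ n * fact n * sqrt pi) powr (-1/2) * exp (t\<^sup>2 / 2) *
     (deriv ^^ n) (\<lambda>s. exp (- s\<^sup>2)) t"

definition hermite_transform :: "(real \<Rightarrow> complex) \<Rightarrow> nat \<Rightarrow> complex" where
  "hermite_transform f n = (LINT t|lborel. f t * of_real (hermite_function n t))"

end

theory Submission
  imports Defs "HOL-Probability.Sinc_Integral" "HOL-Probability.Levy" "HOL-Computational_Algebra.Polynomial"
begin

text \<open>
  The Hermite functions \<open>h\<^sub>n\<close> are Schwartz functions and eigenfunctions of
  \<open>T = d\<^sup>2/dt\<^sup>2 - t\<^sup>2\<close> for the eigenvalues \<open>-(2n+1)\<close>. They may therefore be used as test functions
  in the definition of the maximal operator, and pairing with \<open>h\<^sub>n\<close> diagonalises every operator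
  below it: if \<open>(u, v)\<close> lies in its graph, then \<open>\<langle>v, h\<^sub>n\<rangle> = -(2n+1) \<langle>u, h\<^sub>n\<rangle>\<close>
  (\<open>maximal_hermite_coeff\<close>). The theorem is read off from these scalar equations, in three parts.

  Single-valued extension property. If \<open>(T\<^sub>e - z) \<phi>\<^sub>z = 0\<close> for all \<open>z\<close> in an open set, then
  \<open>(-(2n+1) - z) \<langle>\<phi>\<^sub>z, h\<^sub>n\<rangle> = 0\<close>, so the \<open>n\<close>-th coefficient of \<open>\<phi>\<^sub>z\<close> vanishes except
  possibly at one point, and there too by continuity. The Hermite functions are complete in every
  \<open>L\<^sup>p\<close> (\<open>hermite_complete\<close>): a class \<open>u\<close> without coefficients annihilates all functions
  \<open>t\<^sup>k exp (-t\<^sup>2/2)\<close>, so the Fourier transform of \<open>u\<close> times the Gaussian, which is given by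
  its power series, is zero. Hence \<open>\<phi> = 0\<close>.

  Local spectrum. If \<open>(T\<^sub>e - z) \<phi>\<^sub>z = f\<close>, then \<open>\<phi>\<^sub>z\<close> must have the coefficients
  \<open>\<F>f(n) / (-(2n+1) - z)\<close>. At \<open>z = -(2n+1)\<close> with \<open>\<F>f(n) \<noteq> 0\<close> this is impossible, so such
  points are in the local spectrum. Off the set of these points, which is closed, the Hermite
  series with these coefficients is a solution. The point is that it belongs to the domain of \<open>T\<^sub>e\<close>
  whatever \<open>T\<^sub>e\<close> is, because it is a Schwartz function (\<open>hermite_series_schwartz\<close>): the
  coefficients of a Schwartz function are rapidly decreasing, since \<open>(2n+1)\<^sup>k \<F>f(n)\<close> is up to sign
  a coefficient of \<open>T\<^sup>k f\<close>, while \<open>h\<^sub>n\<close> and \<open>t\<^sup>m h\<^sub>n\<close> grow only polynomially in \<open>n\<close>. The same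
  estimates make the solution analytic in \<open>z\<close>.

  Growth of the powers. Pairing \<open>T\<^sup>k f\<close> with \<open>h\<^sub>n\<close> bounds \<open>(2n+1)\<^sup>k |\<F>f(n)|\<close> by a constant,
  depending on \<open>n\<close>, times \<open>\<parallel>T\<^sup>k f\<parallel>\<^sub>p\<close>. Conversely, if \<open>r\<close> bounds all \<open>2n+1\<close> with
  \<open>\<F>f(n) \<noteq> 0\<close>, then the Hermite series of \<open>T\<^sup>k f\<close> gives \<open>\<parallel>T\<^sup>k f\<parallel>\<^sub>p \<le> M r\<^sup>k\<close>. Taking \<open>k\<close>-th
  roots yields the limit.

  All \<open>L\<^sup>p\<close> estimates go through functions bounded by \<open>C / (1 + t\<^sup>2)\<close>. Such a function has norm
  at most \<open>\<pi> C\<close> in every \<open>L\<^sup>p\<close> (\<open>Lp_norm_decay_le\<close>), and pairing with it is bounded on every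
  \<open>L\<^sup>p\<close> (\<open>Lp_pairing\<close>).
\<close>

section \<open>Schwartz functions\<close>

abbreviation vderiv :: "(real \<Rightarrow> complex) \<Rightarrow> real \<Rightarrow> complex" where
  "vderiv f \<equiv> \<lambda>t. vector_derivative f (at t)"

lemma nth_vderiv_0 [simp]: "nth_vderiv 0 f = f"
  by (simp add: nth_vderiv_def)

lemma nth_vderiv_Suc: "nth_vderiv (Suc n) f = vderiv (nth_vderiv n f)"
  by (simp add: nth_vderiv_def)

lemma nth_vderiv_Suc': "nth_vderiv (Suc n) f = nth_vderiv n (vderiv f)"
  unfolding nth_vderiv_def funpow_Suc_right by (simp add: o_def)

lemma vderiv_eqI: "(\<And>t. (f has_vector_derivative f' t) (at t)) \<Longrightarrow> vderiv f = f'"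
  by (auto simp: fun_eq_iff vector_derivative_at)

text \<open>
  Closure properties of the Schwartz space are awkward to prove from the definition, which speaks of
  all iterated derivatives. It is enough to exhibit a set of functions that is closed under
  differentiation and each member of which decays faster than every power of \<open>t\<close>.
\<close>

lemma schwartz_coinduct:
  assumes "f \<in> A"
    and deriv: "\<And>f. f \<in> A \<Longrightarrow> \<exists>f'\<in>A. \<forall>t. (f has_vector_derivative f' t) (at t)"
    and bound: "\<And>f m. f \<in> A \<Longrightarrow> \<exists>C. \<forall>t. \<bar>t\<bar> ^ m * norm (f t) \<le> C"
  shows "f \<in> schwartz_space"
proof -
  have A: "nth_vderiv n f \<in> A" for n
  proof (induction n)
    case (Suc n)
    from deriv[OF Suc] obtain f' where "f' \<in> A" "\<And>t. (nth_vderiv n f has_vector_derivative f' t) (at t)"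
      by auto
    then show ?case using vderiv_eqI[of "nth_vderiv n f" f'] by (simp add: nth_vderiv_Suc)
  qed (use assms in simp)
  have "nth_vderiv n f differentiable (at t)" for n t
    using deriv[OF A[of n]] by (auto simp: has_vector_derivative_def differentiable_def)
  then show ?thesis using bound[OF A] by (simp add: schwartz_space_def)
qed

lemma schwartz_has_vderiv:
  assumes "f \<in> schwartz_space"
  shows "(f has_vector_derivative vderiv f t) (at t)"
proof -
  have "nth_vderiv 0 f differentiable (at t)"
    using assms unfolding schwartz_space_def by blast
  then show ?thesis by (simp add: vector_derivative_works[symmetric])
qed

lemma schwartz_vderiv: "f \<in> schwartz_space \<Longrightarrow> vderiv f \<in> schwartz_space"
  unfolding schwartz_space_def nth_vderiv_Suc'[symmetric] mem_Collect_eq by blast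

lemma schwartz_bound:
  assumes "f \<in> schwartz_space"
  obtains C where "C \<ge> 0" "\<And>t. \<bar>t\<bar> ^ m * norm (f t) \<le> C"
proof -
  have "\<exists>C. \<forall>t. \<bar>t\<bar> ^ m * norm (nth_vderiv 0 f t) \<le> C"
    using assms unfolding schwartz_space_def by blast
  then obtain C where C: "\<bar>t\<bar> ^ m * norm (f t) \<le> C" for t by auto
  show ?thesis using order_trans[OF _ C[of 0]] C by (intro that[of C]) auto
qed

lemma schwartz_diff:
  assumes "f \<in> schwartz_space" "g \<in> schwartz_space"
  shows "(\<lambda>t. f t - g t) \<in> schwartz_space"
proof (rule schwartz_coinduct)
  let ?A = "{\<lambda>t. f t - g t | f g. f \<in> schwartz_space \<and> g \<in> schwartz_space}"
  show "(\<lambda>t. f t - g t) \<in> ?A" using assms by blast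
  fix k assume "k \<in> ?A"
  then obtain f g where k: "k = (\<lambda>t. f t - g t)" and fg: "f \<in> schwartz_space" "g \<in> schwartz_space" by blast
  show "\<exists>k'\<in>?A. \<forall>t. (k has_vector_derivative k' t) (at t)"
    unfolding k by (rule bexI[of _ "\<lambda>t. vderiv f t - vderiv g t"])
      (use fg in \<open>auto intro!: derivative_intros schwartz_has_vderiv schwartz_vderiv\<close>)
  fix m
  obtain C D where "\<And>t. \<bar>t\<bar> ^ m * norm (f t) \<le> C" "\<And>t. \<bar>t\<bar> ^ m * norm (g t) \<le> D"
    using schwartz_bound fg by metis
  then have "\<bar>t\<bar> ^ m * norm (k t) \<le> C + D" for t
    using mult_left_mono[OF norm_triangle_ineq4[of "f t" "g t"], of "\<bar>t\<bar>^m"]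
      add_mono[of "\<bar>t\<bar> ^ m * norm (f t)" C "\<bar>t\<bar> ^ m * norm (g t)" D]
    by (simp add: k distrib_left)
  then show "\<exists>C. \<forall>t. \<bar>t\<bar> ^ m * norm (k t) \<le> C" by blast
qed

lemma schwartz_cmult:
  assumes "f \<in> schwartz_space"
  shows "(\<lambda>t. c * f t) \<in> schwartz_space"
proof (rule schwartz_coinduct)
  let ?A = "{\<lambda>t. c * f t | f. f \<in> schwartz_space}"
  show "(\<lambda>t. c * f t) \<in> ?A" using assms by blast
  fix k assume "k \<in> ?A"
  then obtain f where k: "k = (\<lambda>t. c * f t)" and f: "f \<in> schwartz_space" by blast
  show "\<exists>k'\<in>?A. \<forall>t. (k has_vector_derivative k' t) (at t)"
    unfolding k by (rule bexI[of _ "\<lambda>t. c * vderiv f t"])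
      (use f in \<open>auto intro!: derivative_intros has_vector_derivative_mult_right schwartz_has_vderiv schwartz_vderiv\<close>)
  fix m
  obtain C where C: "\<And>t. \<bar>t\<bar> ^ m * norm (f t) \<le> C"
    using schwartz_bound f by metis
  then have "\<bar>t\<bar> ^ m * norm (k t) \<le> norm c * C" for t
    using mult_left_mono[OF C[of t], of "norm c"] by (simp add: k norm_mult mult_ac)
  then show "\<exists>C. \<forall>t. \<bar>t\<bar> ^ m * norm (k t) \<le> C" by blast
qed

lemma schwartz_times_id:
  assumes "f \<in> schwartz_space"
  shows "(\<lambda>t. of_real t * f t) \<in> schwartz_space"
proof (rule schwartz_coinduct)
  \<comment> \<open>Differentiating \<open>t f\<close> gives \<open>f + t f'\<close>; the sums \<open>g + t f\<close> are closed under differentiation.\<close>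
  let ?A = "{\<lambda>t. g t + of_real t * f t | f g. f \<in> schwartz_space \<and> g \<in> schwartz_space}"
  show "(\<lambda>t. of_real t * f t) \<in> ?A"
    using assms schwartz_diff[OF assms assms] by force
  fix k assume "k \<in> ?A"
  then obtain f g where k: "k = (\<lambda>t. g t + of_real t * f t)"
    and fg: "f \<in> schwartz_space" "g \<in> schwartz_space" by blast
  have "(k has_vector_derivative (vderiv g t + f t) + of_real t * vderiv f t) (at t)" for t
    unfolding k
    by (rule derivative_eq_intros has_vector_derivative_mult has_vector_derivative_of_real
        schwartz_has_vderiv fg refl | simp)+
  moreover have "(\<lambda>t. vderiv g t + f t) \<in> schwartz_space"
    using schwartz_diff[OF schwartz_vderiv[OF fg(2)] schwartz_cmult[OF fg(1), of "-1"]] by simp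
  moreover from this have "(\<lambda>t. (vderiv g t + f t) + of_real t * vderiv f t) \<in> ?A"
    unfolding mem_Collect_eq using schwartz_vderiv[OF fg(1)]
    by (intro exI[of _ "vderiv f"] exI[of _ "\<lambda>t. vderiv g t + f t"]) simp
  ultimately show "\<exists>k'\<in>?A. \<forall>t. (k has_vector_derivative k' t) (at t)"
    by (intro bexI[of _ "\<lambda>t. (vderiv g t + f t) + of_real t * vderiv f t"]) auto
  fix m
  obtain C D where CD: "\<And>t. \<bar>t\<bar> ^ Suc m * norm (f t) \<le> C" "\<And>t. \<bar>t\<bar> ^ m * norm (g t) \<le> D"
    using schwartz_bound fg by metis
  have "\<bar>t\<bar> ^ m * norm (k t) \<le> D + C" for t
    using mult_left_mono[OF norm_triangle_ineq[of "g t" "of_real t * f t"], of "\<bar>t\<bar>^m"] CD[of t]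
    by (auto simp: k distrib_left norm_mult mult_ac)
  then show "\<exists>C. \<forall>t. \<bar>t\<bar> ^ m * norm (k t) \<le> C" by blast
qed

lemma hermite_diff_eq: "hermite_diff f t = vderiv (vderiv f) t - of_real t * (of_real t * f t)"
  by (simp add: hermite_diff_def numeral_2_eq_2 nth_vderiv_Suc)

lemma schwartz_hermite_diff:
  assumes "f \<in> schwartz_space"
  shows "hermite_diff f \<in> schwartz_space"
proof -
  have "hermite_diff f = (\<lambda>t. vderiv (vderiv f) t - of_real t * (of_real t * f t))"
    by (auto simp: hermite_diff_eq)
  then show ?thesis
    using assms by (simp add: schwartz_diff schwartz_vderiv schwartz_times_id)
qed

lemma schwartz_continuous: "f \<in> schwartz_space \<Longrightarrow> continuous_on UNIV f"
  by (meson continuous_at_imp_continuous_on has_vector_derivative_continuous schwartz_has_vderiv)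

lemma schwartz_borel: "f \<in> schwartz_space \<Longrightarrow> f \<in> borel_measurable borel"
  by (intro borel_measurable_continuous_onI schwartz_continuous)

section \<open>Functions of quadratic decay\<close>

text \<open>
  The weight \<open>1 / (1 + t\<^sup>2)\<close> is bounded and integrable, so functions dominated by it lie in every
  \<open>L\<^sup>p\<close> and define bounded functionals on every \<open>L\<^sup>p\<close>, uniformly in \<open>p\<close>.
\<close>

definition decay :: "real \<Rightarrow> (real \<Rightarrow> complex) \<Rightarrow> bool" where
  "decay C f \<longleftrightarrow> f \<in> borel_measurable borel \<and> (\<forall>t. norm (f t) \<le> C / (1 + t\<^sup>2))"

lemma one_plus_sq_pos [simp]: "0 < 1 + (t::real)\<^sup>2" "1 + t\<^sup>2 \<noteq> 0"
  by (auto simp: add_pos_nonneg add_nonneg_eq_0_iff)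

lemma decay_nonneg: "decay C f \<Longrightarrow> 0 \<le> C"
  unfolding decay_def using order_trans[OF norm_ge_zero[of "f 0"]]
  by (metis add.right_neutral div_by_1 zero_power2)

lemma decay_le: "decay C f \<Longrightarrow> norm (f t) \<le> C"
proof -
  assume d: "decay C f"
  then have "norm (f t) \<le> C / (1 + t\<^sup>2)" by (simp add: decay_def)
  also have "\<dots> \<le> C / 1" using decay_nonneg[OF d] by (intro divide_left_mono) auto
  finally show ?thesis by simp
qed

lemma schwartz_decay:
  assumes "f \<in> schwartz_space"
  obtains C where "decay C f"
proof -
  obtain C D where CD: "\<And>t. \<bar>t\<bar> ^ 0 * norm (f t) \<le> C" "\<And>t. \<bar>t\<bar> ^ 2 * norm (f t) \<le> D"
    using schwartz_bound assms by metis
  have "(1 + t\<^sup>2) * norm (f t) \<le> C + D" for t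
    using CD[of t] by (simp add: algebra_simps)
  then have "decay (C + D) f"
    using schwartz_borel[OF assms] by (auto simp: decay_def field_simps)
  then show ?thesis by (rule that)
qed

lemma integrable_inverse_one_plus_sq: "integrable lborel (\<lambda>t::real. 1 / (1 + t\<^sup>2))"
  using integrable_inverse_1_plus_square
  by (simp add: set_integrable_def einterval_def inverse_eq_divide)

lemma integral_inverse_one_plus_sq: "(LINT t|lborel. 1 / (1 + t\<^sup>2)) = pi"
  using LBINT_inverse_1_plus_square
  by (simp add: interval_lebesgue_integral_def set_lebesgue_integral_def einterval_def inverse_eq_divide)

lemma integrable_decay:
  assumes "decay C f"
  shows "integrable lborel f"
proof (rule Bochner_Integration.integrable_bound)
  show "integrable lborel (\<lambda>t. C * (1 / (1 + t\<^sup>2)))"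
    by (intro integrable_mult_right integrable_inverse_one_plus_sq)
  show "f \<in> borel_measurable lborel" using assms by (simp add: decay_def)
  show "AE t in lborel. norm (f t) \<le> norm (C * (1 / (1 + t\<^sup>2)))"
    using assms decay_nonneg[OF assms] by (auto simp: decay_def)
qed

lemma decay_mult_bounded:
  assumes "decay C f" "g \<in> borel_measurable borel" "\<And>t. norm (g t) \<le> B"
  shows "decay (B * C) (\<lambda>t. g t * f t)"
  unfolding decay_def
proof (intro conjI allI)
  have [measurable]: "f \<in> borel_measurable borel" "g \<in> borel_measurable borel"
    using assms by (auto simp: decay_def)
  show "(\<lambda>t. g t * f t) \<in> borel_measurable borel" by measurable
  fix t
  have "norm (g t * f t) \<le> B * (C / (1 + t\<^sup>2))" unfolding norm_mult
    using assms order_trans[OF norm_ge_zero assms(3)[of t]]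
    by (intro mult_mono) (auto simp: decay_def)
  then show "norm (g t * f t) \<le> B * C / (1 + t\<^sup>2)" by simp
qed

lemma integrable_schwartz: "f \<in> schwartz_space \<Longrightarrow> integrable lborel f"
  by (meson schwartz_decay integrable_decay)

lemma schwartz_mult_bounded_decay:
  assumes "f \<in> schwartz_space" "g \<in> schwartz_space"
  obtains C where "decay C (\<lambda>t. f t * g t)"
proof -
  obtain C D where "decay C f" "decay D g" using assms schwartz_decay by metis
  then have "decay (C * D) (\<lambda>t. f t * g t)"
    using decay_mult_bounded[of D g f C] decay_le[of C f] by (auto simp: decay_def)
  then show ?thesis by (rule that)
qed

lemma integrable_schwartz_mult:
  "f \<in> schwartz_space \<Longrightarrow> g \<in> schwartz_space \<Longrightarrow> integrable lborel (\<lambda>t. f t * g t)"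
  by (rule schwartz_mult_bounded_decay[of f g]) (auto intro: integrable_decay)

lemma decay_tendsto_0:
  assumes "decay C f"
  shows "(f \<longlongrightarrow> 0) at_top" "(f \<longlongrightarrow> 0) at_bot"
proof -
  have *: "((\<lambda>t::real. C / (1 + t\<^sup>2)) \<longlongrightarrow> 0) F" if "F = at_top \<or> F = at_bot" for F
  proof -
    have "filterlim (\<lambda>t::real. t^2) at_top F"
      using that filterlim_pow_at_top[OF _ filterlim_ident, of 2]
        filterlim_pow_at_bot_even[OF _ filterlim_ident, of 2] by auto
    then have "filterlim (\<lambda>t::real. 1 + t^2) at_top F"
      by (intro filterlim_tendsto_add_at_top[OF tendsto_const])
    then show ?thesis by (intro tendsto_divide_0[OF tendsto_const] filterlim_at_top_imp_at_infinity)
  qed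
  show "(f \<longlongrightarrow> 0) at_top" "(f \<longlongrightarrow> 0) at_bot"
    using assms by (auto intro!: Lim_null_comparison[OF _ *] simp: decay_def)
qed

text \<open>
  Integration by parts; the boundary terms vanish because the product of two Schwartz functions
  tends to zero at both ends.
\<close>

lemma integral_schwartz_product_deriv:
  assumes fg: "f \<in> schwartz_space" "g \<in> schwartz_space"
  shows "(LINT t|lborel. f t * vderiv g t) = - (LINT t|lborel. vderiv f t * g t)"
proof -
  note fg' = schwartz_vderiv[OF fg(1)] schwartz_vderiv[OF fg(2)]
  note int = integrable_schwartz_mult[OF fg(1) fg'(2)] integrable_schwartz_mult[OF fg'(1) fg(2)]
  obtain C where C: "decay C (\<lambda>t. f t * g t)"
    using schwartz_mult_bounded_decay fg by metis
  have "(LBINT t=-\<infinity>..\<infinity>. f t * vderiv g t + vderiv f t * g t) = 0 - 0"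
  proof (rule interval_integral_FTC_integrable)
    show "((\<lambda>t. f t * g t) has_vector_derivative f t * vderiv g t + vderiv f t * g t) (at t)" for t
      by (intro has_vector_derivative_mult schwartz_has_vderiv fg)
    show "isCont (\<lambda>t. f t * vderiv g t + vderiv f t * g t) t" for t
      by (rule continuous_on_interior[of UNIV]) (auto intro!: continuous_intros schwartz_continuous[OF fg(1)] schwartz_continuous[OF fg(2)]
          schwartz_continuous[OF fg'(1)] schwartz_continuous[OF fg'(2)])
    show "set_integrable lborel (einterval (-\<infinity>) \<infinity>) (\<lambda>t. f t * vderiv g t + vderiv f t * g t)"
      using int by (auto simp: set_integrable_def einterval_def)
    show "(((\<lambda>t. f t * g t) \<circ> real_of_ereal) \<longlongrightarrow> 0) (at_right (-\<infinity>))"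
      "(((\<lambda>t. f t * g t) \<circ> real_of_ereal) \<longlongrightarrow> 0) (at_left \<infinity>)"
      using decay_tendsto_0[OF C] by (simp_all add: ereal_tendsto_simps1)
  qed auto
  then have "(LINT t|lborel. f t * vderiv g t + vderiv f t * g t) = 0"
    by (simp add: interval_lebesgue_integral_def set_lebesgue_integral_def einterval_def)
  then show ?thesis using int by (simp add: eq_neg_iff_add_eq_0)
qed

lemma hermite_diff_symmetric:
  assumes fg: "f \<in> schwartz_space" "g \<in> schwartz_space"
  shows "(LINT t|lborel. hermite_diff f t * g t) = (LINT t|lborel. f t * hermite_diff g t)"
proof -
  note f = fg(1) and g = fg(2)
  note f' = schwartz_vderiv[OF f] and g' = schwartz_vderiv[OF g]
  note f'' = schwartz_vderiv[OF f'] and g'' = schwartz_vderiv[OF g']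
  note tf = schwartz_times_id[OF f] and tg = schwartz_times_id[OF g]
  have "(LINT t|lborel. vderiv (vderiv f) t * g t) = (LINT t|lborel. f t * vderiv (vderiv g) t)"
    using integral_schwartz_product_deriv[OF f' g] integral_schwartz_product_deriv[OF f g'] by simp
  moreover have "(LINT t|lborel. of_real t * (of_real t * f t) * g t) =
      (LINT t|lborel. f t * (of_real t * (of_real t * g t)))"
    by (simp add: mult_ac)
  moreover have "(LINT t|lborel. hermite_diff f t * g t) =
      (LINT t|lborel. vderiv (vderiv f) t * g t) - (LINT t|lborel. of_real t * (of_real t * f t) * g t)"
    unfolding hermite_diff_eq left_diff_distrib
    by (intro Bochner_Integration.integral_diff integrable_schwartz_mult f'' g schwartz_times_id f)
  moreover have "(LINT t|lborel. f t * hermite_diff g t) =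
      (LINT t|lborel. f t * vderiv (vderiv g) t) - (LINT t|lborel. f t * (of_real t * (of_real t * g t)))"
    unfolding hermite_diff_eq right_diff_distrib
    by (intro Bochner_Integration.integral_diff integrable_schwartz_mult g'' f schwartz_times_id g)
  ultimately show ?thesis by simp
qed

section \<open>Hermite functions\<close>

text \<open>
  With this sign convention the \<open>n\<close>-th derivative of \<open>exp (-t\<^sup>2)\<close> is \<open>hermite_poly n\<close> times
  \<open>exp (-t\<^sup>2)\<close>, so this is \<open>(-1)\<^sup>n\<close> times the physicists' Hermite polynomial.
\<close>

primrec hermite_poly :: "nat \<Rightarrow> real poly" where
  "hermite_poly 0 = 1"
| "hermite_poly (Suc n) = pderiv (hermite_poly n) - [:0, 2:] * hermite_poly n"

lemma pderiv_hermite_poly: "pderiv (hermite_poly n) = smult (- 2 * of_nat n) (hermite_poly (n - 1))"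
proof (induction n)
  case (Suc n)
  have "pderiv (hermite_poly (Suc n)) = pderiv (pderiv (hermite_poly n))
      - ([:2:] * hermite_poly n + [:0, 2:] * pderiv (hermite_poly n))"
    by (simp add: pderiv_diff pderiv_mult pderiv_pCons pderiv_smult algebra_simps)
  also have "\<dots> = smult (- 2 * of_nat n) (pderiv (hermite_poly (n - 1)) - [:0, 2:] * hermite_poly (n - 1))
      - smult 2 (hermite_poly n)"
    unfolding Suc.IH pderiv_smult by (simp add: smult_diff_right algebra_simps)
  also have "\<dots> = smult (- 2 * of_nat (Suc n)) (hermite_poly n)"
  proof (cases n)
    case (Suc m)
    then have "pderiv (hermite_poly (n - 1)) - [:0, 2:] * hermite_poly (n - 1) = hermite_poly n" by simp
    moreover have "smult (- 2 * real n) (hermite_poly n) - smult 2 (hermite_poly n)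
        = smult (- 2 * real (Suc n)) (hermite_poly n)"
      by (subst smult_diff_left[symmetric]) (rule arg_cong2[of _ _ _ _ smult], auto)
    ultimately show ?thesis by (simp only:)
  qed simp
  finally show ?case by simp
qed (simp add: pderiv_1)

lemma gauss_deriv: "(deriv ^^ n) (\<lambda>s::real. exp (- s\<^sup>2)) = (\<lambda>t. poly (hermite_poly n) t * exp (- t\<^sup>2))"
proof (induction n)
  case (Suc n)
  have "((\<lambda>t. poly (hermite_poly n) t * exp (- t\<^sup>2)) has_real_derivative
      poly (hermite_poly (Suc n)) t * exp (- t\<^sup>2)) (at t)" for t
    by (auto intro!: derivative_eq_intros poly_DERIV simp: algebra_simps)
  then show ?case by (auto simp: Suc.IH fun_eq_iff intro: DERIV_imp_deriv)
qed simp

definition hermite_norm_const :: "nat \<Rightarrow> real" where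
  "hermite_norm_const n = (-1) ^ n * (2 ^ n * fact n * sqrt pi) powr (-1/2)"

lemma hermite_function_poly:
  "hermite_function n t = hermite_norm_const n * poly (hermite_poly n) t * exp (- (t\<^sup>2) / 2)"
proof -
  have "exp (t\<^sup>2 / 2) * exp (- t\<^sup>2) = exp (- (t\<^sup>2) / 2)"
    by (simp add: exp_add[symmetric])
  then show ?thesis
    by (simp add: hermite_function_def gauss_deriv hermite_norm_const_def)
qed

text \<open>
  The matrix entries of multiplication by \<open>t\<close> and, up to sign, of \<open>d/dt\<close> in the Hermite basis. Since
  \<open>ladder 0 = 0\<close>, terms with index \<open>n - 1\<close> disappear for \<open>n = 0\<close> and need no case distinction.
\<close>

definition ladder :: "nat \<Rightarrow> real" where
  "ladder n = sqrt (real n / 2)"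

lemma ladder_0 [simp]: "ladder 0 = 0"
  by (simp add: ladder_def)

lemma ladder_nonneg [simp]: "0 \<le> ladder n"
  by (simp add: ladder_def)

lemma ladder_sq: "ladder n * ladder n = real n / 2"
  by (simp add: ladder_def)

lemma ladder_le: "ladder n \<le> real n"
proof -
  have "real n / 2 \<le> (real n)\<^sup>2"
    by (cases n) (auto simp: power2_eq_square field_simps intro: order_trans)
  then show ?thesis by (simp add: ladder_def real_le_lsqrt)
qed

lemma hermite_norm_const_Suc:
  "2 * ladder (Suc n) * hermite_norm_const (Suc n) = - hermite_norm_const n"
proof -
  have "2 * ladder (Suc n) = (2 * real (Suc n)) powr (1/2)"
    using real_sqrt_mult[of 4 "real (Suc n) / 2"] by (simp add: ladder_def powr_half_sqrt add_divide_distrib)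
  moreover have "(2 ^ Suc n * fact (Suc n) * sqrt pi) powr (-1/2) =
      (2 * real (Suc n)) powr (-1/2) * (2 ^ n * fact n * sqrt pi) powr (-1/2)"
    by (simp add: powr_mult[symmetric] algebra_simps)
  moreover have "(2 * real (Suc n)) powr (1/2) * (2 * real (Suc n)) powr (-1/2) = 1"
    by (subst powr_add[symmetric]) simp
  ultimately show ?thesis by (simp add: hermite_norm_const_def)
qed

text \<open>
  The three-term recurrence of the Hermite polynomials, which comes from
  \<open>pderiv_hermite_poly\<close>, written for the normalised functions.
\<close>

lemma hermite_recurrence:
  "t * hermite_function n t =
     ladder (Suc n) * hermite_function (Suc n) t + ladder n * hermite_function (n - 1) t"
proof -
  define e where "e = exp (- (t\<^sup>2) / 2)"
  define P where "P k = poly (hermite_poly k) t" for k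
  define K where "K = hermite_norm_const"
  have P: "P (Suc n) = - 2 * real n * P (n - 1) - 2 * t * P n"
    by (simp add: P_def pderiv_hermite_poly)
  have "2 * real n * K n = - 2 * ladder n * K (n - 1)"
  proof (cases n)
    case (Suc m)
    have "2 * real n * K n = 2 * ladder n * (2 * ladder n * K n)"
      using ladder_sq[of n] by (simp add: algebra_simps)
    also have "2 * ladder n * K n = - K m"
      using hermite_norm_const_Suc[of m] Suc by (simp add: K_def)
    finally show ?thesis by (simp add: Suc)
  qed simp
  note K = this
  have "2 * ladder (Suc n) * K (Suc n) * P (Suc n) = K n * (2 * real n * P (n - 1) + 2 * t * P n)"
    using hermite_norm_const_Suc[of n] by (simp add: K_def P algebra_simps)
  also have "\<dots> = - 2 * ladder n * K (n - 1) * P (n - 1) + 2 * t * K n * P n"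
    unfolding K[symmetric] by (simp add: algebra_simps)
  finally have "2 * t * K n * P n = 2 * ladder (Suc n) * K (Suc n) * P (Suc n) + 2 * ladder n * K (n - 1) * P (n - 1)"
    by simp
  then have "2 * t * K n * P n * e = (2 * ladder (Suc n) * K (Suc n) * P (Suc n) + 2 * ladder n * K (n - 1) * P (n - 1)) * e"
    by simp
  then show ?thesis
    by (simp add: hermite_function_poly P_def K_def e_def algebra_simps)
qed

lemma hermite_function_deriv:
  "(hermite_function n has_real_derivative
     t * hermite_function n t - 2 * ladder (Suc n) * hermite_function (Suc n) t) (at t)"
proof -
  have "((\<lambda>t. hermite_norm_const n * poly (hermite_poly n) t * exp (- (t\<^sup>2) / 2)) has_real_derivative
     hermite_norm_const n * (poly (pderiv (hermite_poly n)) t - t * poly (hermite_poly n) t) * exp (- (t\<^sup>2) / 2)) (at t)"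
    by (auto intro!: derivative_eq_intros poly_DERIV simp: algebra_simps)
  moreover have "hermite_function n = (\<lambda>t. hermite_norm_const n * poly (hermite_poly n) t * exp (- (t\<^sup>2) / 2))"
    by (auto simp: hermite_function_poly)
  moreover have "2 * ladder (Suc n) * hermite_function (Suc n) t =
      (2 * ladder (Suc n) * hermite_norm_const (Suc n)) * poly (hermite_poly (Suc n)) t * exp (- (t\<^sup>2) / 2)"
    unfolding hermite_function_poly by simp
  then have "t * hermite_function n t - 2 * ladder (Suc n) * hermite_function (Suc n) t =
      hermite_norm_const n * (poly (pderiv (hermite_poly n)) t - t * poly (hermite_poly n) t) * exp (- (t\<^sup>2) / 2)"
    unfolding hermite_norm_const_Suc by (simp add: hermite_function_poly algebra_simps)
  ultimately show ?thesis by (simp only:)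
qed

text \<open>
  Together with the recurrence above: \<open>h\<^sub>n\<close> is moved to its neighbours by both \<open>t\<close> and \<open>d/dt\<close>, so
  series in the \<open>h\<^sub>n\<close> can be multiplied by \<open>t\<close> and differentiated by acting on coefficients.
\<close>

lemma hermite_function_deriv':
  "(hermite_function n has_real_derivative
     ladder n * hermite_function (n - 1) t - ladder (Suc n) * hermite_function (Suc n) t) (at t)"
  using hermite_function_deriv[of n t] by (simp add: hermite_recurrence[of t n])

lemma abs_power_le_exp: "\<exists>C. \<forall>t::real. \<bar>t\<bar> ^ m * exp (- (t\<^sup>2) / 2) \<le> C"
proof (cases m)
  case (Suc k)
  \<comment> \<open>This comes from \<open>|t| \<le> m + t\<^sup>2/2 \<le> m exp (t\<^sup>2 / (2m))\<close>.\<close>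
  have "\<bar>t\<bar> ^ m * exp (- (t\<^sup>2) / 2) \<le> real m ^ m" for t :: real
  proof -
    let ?x = "t\<^sup>2 / 2"
    have "0 \<le> (\<bar>t\<bar> - 1)\<^sup>2" by simp
    then have "\<bar>t\<bar> \<le> 1 + ?x" by (simp add: power2_diff)
    also have "\<dots> \<le> real m + ?x" using Suc by simp
    also have "\<dots> = real m * (1 + ?x / real m)" using Suc by (simp add: field_simps)
    also have "\<dots> \<le> real m * exp (?x / real m)"
      by (intro mult_left_mono exp_ge_add_one_self) auto
    finally have "\<bar>t\<bar> ^ m \<le> (real m * exp (?x / real m)) ^ m" by (intro power_mono) auto
    also have "\<dots> = real m ^ m * exp ?x"
      using exp_of_nat_mult[of m "?x / real m"] Suc by (simp add: power_mult_distrib del: of_nat_Suc)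
    finally show ?thesis by (simp add: exp_minus field_simps)
  qed
  then show ?thesis by blast
qed (auto intro!: exI[of _ 1])

lemma poly_gauss_bound: "\<exists>C. \<forall>t::real. \<bar>t\<bar> ^ m * \<bar>poly q t * exp (- (t\<^sup>2) / 2)\<bar> \<le> C"
proof (induction q arbitrary: m)
  case (pCons a q)
  obtain C where C: "\<bar>t\<bar> ^ m * exp (- (t\<^sup>2) / 2) \<le> C" for t :: real
    using abs_power_le_exp by blast
  obtain D where D: "\<bar>t\<bar> ^ Suc m * \<bar>poly q t * exp (- (t\<^sup>2) / 2)\<bar> \<le> D" for t :: real
    using pCons.IH by blast
  have "\<bar>t\<bar> ^ m * \<bar>poly (pCons a q) t * exp (- (t\<^sup>2) / 2)\<bar> \<le> \<bar>a\<bar> * C + D" for t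
  proof -
    have "\<bar>a + t * poly q t\<bar> \<le> \<bar>a\<bar> + \<bar>t\<bar> * \<bar>poly q t\<bar>"
      by (metis abs_mult abs_triangle_ineq)
    from mult_left_mono[OF this, of "\<bar>t\<bar> ^ m * exp (- (t\<^sup>2) / 2)"]
    have "\<bar>t\<bar> ^ m * \<bar>poly (pCons a q) t * exp (- (t\<^sup>2) / 2)\<bar> \<le>
       \<bar>a\<bar> * (\<bar>t\<bar> ^ m * exp (- (t\<^sup>2) / 2)) + \<bar>t\<bar> ^ Suc m * \<bar>poly q t * exp (- (t\<^sup>2) / 2)\<bar>"
      unfolding poly_pCons abs_mult abs_exp_cancel by (simp add: algebra_simps)
    also have "\<dots> \<le> \<bar>a\<bar> * C + D"
      by (intro add_mono mult_left_mono C D) auto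
    finally show ?thesis .
  qed
  then show ?case by blast
qed auto

lemma poly_gauss_schwartz: "(\<lambda>t. of_real (poly q t * exp (- (t\<^sup>2) / 2))) \<in> schwartz_space"
proof (rule schwartz_coinduct)
  let ?A = "{\<lambda>t. of_real (poly q t * exp (- (t\<^sup>2) / 2)) :: complex | q. True}"
  show "(\<lambda>t. of_real (poly q t * exp (- (t\<^sup>2) / 2))) \<in> ?A" by blast
  fix k :: "real \<Rightarrow> complex" assume "k \<in> ?A"
  then obtain q where k: "k = (\<lambda>t. of_real (poly q t * exp (- (t\<^sup>2) / 2)))" by blast
  have "((\<lambda>t. poly q t * exp (- (t\<^sup>2) / 2)) has_real_derivative
      poly (pderiv q - [:0, 1:] * q) t * exp (- (t\<^sup>2) / 2)) (at t)" for t
    by (auto intro!: derivative_eq_intros poly_DERIV simp: algebra_simps)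
  then have "(k has_vector_derivative of_real (poly (pderiv q - [:0, 1:] * q) t * exp (- (t\<^sup>2) / 2))) (at t)" for t
    unfolding k by (intro has_vector_derivative_of_real) (simp add: has_real_derivative_iff_has_vector_derivative)
  then show "\<exists>k'\<in>?A. \<forall>t. (k has_vector_derivative k' t) (at t)"
    by (intro bexI[of _ "\<lambda>t. of_real (poly (pderiv q - [:0, 1:] * q) t * exp (- (t\<^sup>2) / 2))"]) blast+
  fix m show "\<exists>C. \<forall>t. \<bar>t\<bar> ^ m * norm (k t) \<le> C"
    using poly_gauss_bound[of m q] unfolding k norm_of_real .
qed

abbreviation hermite_fun :: "nat \<Rightarrow> real \<Rightarrow> complex" where
  "hermite_fun n \<equiv> \<lambda>t. of_real (hermite_function n t)"

lemma hermite_schwartz: "hermite_fun n \<in> schwartz_space"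
  using poly_gauss_schwartz[of "smult (hermite_norm_const n) (hermite_poly n)"]
  by (simp add: hermite_function_poly)

lemma hermite_fun_has_vderiv:
  "(hermite_fun n has_vector_derivative
     of_real (t * hermite_function n t - 2 * ladder (Suc n) * hermite_function (Suc n) t)) (at t)"
  "(hermite_fun n has_vector_derivative
     of_real (ladder n * hermite_function (n - 1) t - ladder (Suc n) * hermite_function (Suc n) t)) (at t)"
  using hermite_function_deriv[of n t] hermite_function_deriv'[of n t]
  by (auto intro!: has_vector_derivative_of_real simp: has_real_derivative_iff_has_vector_derivative
      simp del: of_real_mult of_real_diff)

lemma hermite_eigenfunction: "hermite_diff (hermite_fun n) t = - (2 * of_nat n + 1) * hermite_fun n t"
proof -
  let ?h = hermite_function
  have 1: "vderiv (hermite_fun n) = (\<lambda>t. of_real (t * ?h n t - 2 * ladder (Suc n) * ?h (Suc n) t))"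
    by (intro vderiv_eqI hermite_fun_has_vderiv)
  have deriv_Suc: "(?h (Suc n) has_real_derivative 2 * ladder (Suc n) * ?h n t - t * ?h (Suc n) t) (at t)"
    using hermite_function_deriv'[of "Suc n" t] hermite_recurrence[of t "Suc n"]
    by (simp add: algebra_simps)
  have "((\<lambda>t. t * ?h n t - 2 * ladder (Suc n) * ?h (Suc n) t) has_real_derivative
     ?h n t + t * (t * ?h n t - 2 * ladder (Suc n) * ?h (Suc n) t)
      - 2 * ladder (Suc n) * (2 * ladder (Suc n) * ?h n t - t * ?h (Suc n) t)) (at t)"
    by (rule derivative_eq_intros deriv_Suc hermite_function_deriv refl | simp)+
  also have "?h n t + t * (t * ?h n t - 2 * ladder (Suc n) * ?h (Suc n) t)
      - 2 * ladder (Suc n) * (2 * ladder (Suc n) * ?h n t - t * ?h (Suc n) t)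
     = (1 + t * t - 4 * (ladder (Suc n) * ladder (Suc n))) * ?h n t"
    by (simp add: algebra_simps)
  also have "\<dots> = (t * t - (2 * real n + 1)) * ?h n t"
    unfolding ladder_sq by (simp add: field_simps)
  finally have "vderiv (vderiv (hermite_fun n)) t = of_real ((t * t - (2 * real n + 1)) * ?h n t)"
    unfolding 1 by (intro vector_derivative_at has_vector_derivative_of_real)
      (simp add: has_real_derivative_iff_has_vector_derivative)
  then show ?thesis by (simp add: hermite_diff_eq algebra_simps)
qed

text \<open>
Eigenfunctions of a symmetric operator for different eigenvalues.
\<close>

lemma hermite_orthogonal:
  assumes "n \<noteq> m"
  shows "(LINT t|lborel. hermite_fun n t * hermite_fun m t) = 0"
proof -
  let ?I = "LINT t|lborel. hermite_fun n t * hermite_fun m t"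
  have "(LINT t|lborel. hermite_diff (hermite_fun n) t * hermite_fun m t) = - (2 * of_nat n + 1) * ?I"
    unfolding hermite_eigenfunction mult.assoc by (rule integral_mult_right_zero)
  moreover have "(LINT t|lborel. hermite_fun n t * hermite_diff (hermite_fun m) t) = - (2 * of_nat m + 1) * ?I"
    unfolding hermite_eigenfunction mult.left_commute[of "hermite_fun n _"] by (rule integral_mult_right_zero)
  ultimately have "- (2 * of_nat n + 1) * ?I = - (2 * of_nat m + 1) * ?I"
    using hermite_diff_symmetric[OF hermite_schwartz hermite_schwartz, of n m] by (simp only:)
  moreover have "- (2 * of_nat n + 1) \<noteq> (- (2 * of_nat m + 1) :: complex)"
    using assms by simp
  ultimately show ?thesis unfolding mult_cancel_right by blast
qed

text \<open>
  Induction on \<open>n\<close>. Writing \<open>a\<close> for \<open>ladder (Suc n)\<close>, the derivatives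
  \<open>h\<^sub>n' = t h\<^sub>n - 2a h\<^sub>n\<^sub>+\<^sub>1\<close> and \<open>h\<^sub>n\<^sub>+\<^sub>1' = 2a h\<^sub>n - t h\<^sub>n\<^sub>+\<^sub>1\<close> inserted into
  \<open>\<integral> h\<^sub>n\<^sub>+\<^sub>1 h\<^sub>n' = - \<integral> h\<^sub>n\<^sub>+\<^sub>1' h\<^sub>n\<close> make the mixed terms cancel and leave
  \<open>\<integral> h\<^sub>n\<^sub>+\<^sub>1\<^sup>2 = \<integral> h\<^sub>n\<^sup>2\<close>. The case \<open>n = 0\<close> is the Gaussian integral.
\<close>

lemma hermite_normalised: "(LINT t|lborel. hermite_fun n t * hermite_fun n t) = 1"
proof (induction n)
  case 0
  have "(LINT t|lborel. hermite_function 0 t * hermite_function 0 t) =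
      (LINT t|lborel. normal_density 0 (1 / sqrt 2) t)"
  proof (intro Bochner_Integration.integral_cong refl)
    fix t :: real
    have "(sqrt pi powr (-1/2)) * (sqrt pi powr (-1/2)) = 1 / sqrt pi"
      by (subst powr_add[symmetric]) (simp add: powr_minus inverse_eq_divide)
    moreover have "exp (- (t\<^sup>2) / 2) * exp (- (t\<^sup>2) / 2) = exp (- t\<^sup>2)"
      by (simp add: exp_add[symmetric])
    moreover have "hermite_function 0 t * hermite_function 0 t =
      ((sqrt pi powr (-1/2)) * (sqrt pi powr (-1/2))) * (exp (- (t\<^sup>2) / 2) * exp (- (t\<^sup>2) / 2))"
      by (simp add: hermite_function_poly hermite_norm_const_def)
    ultimately show "hermite_function 0 t * hermite_function 0 t = normal_density 0 (1 / sqrt 2) t"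
      by (simp add: normal_density_def power_divide)
  qed
  also have "\<dots> = 1"
    using integral_normal_density[of "1 / sqrt 2" 0] by simp
  finally show ?case
    unfolding of_real_mult[symmetric] integral_complex_of_real by simp
next
  case (Suc n)
  let ?H = hermite_fun and ?a = "of_real (2 * ladder (Suc n)) :: complex"
  note tH = schwartz_times_id[OF hermite_schwartz]
  have v: "vderiv (?H n) t = of_real t * ?H n t - ?a * ?H (Suc n) t" for t
    using hermite_fun_has_vderiv(1)[of n t] by (intro vector_derivative_at) simp
  have v': "vderiv (?H (Suc n)) t = ?a * ?H n t - of_real t * ?H (Suc n) t" for t
  proof (rule vector_derivative_at)
    show "(?H (Suc n) has_vector_derivative ?a * ?H n t - of_real t * ?H (Suc n) t) (at t)"
      using hermite_fun_has_vderiv(2)[of "Suc n" t] hermite_recurrence[of t "Suc n"]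
      by (simp add: algebra_simps flip: of_real_mult of_real_diff of_real_add)
  qed
  have "(LINT t|lborel. ?H (Suc n) t * vderiv (?H n) t) = - (LINT t|lborel. vderiv (?H (Suc n)) t * ?H n t)"
    by (intro integral_schwartz_product_deriv hermite_schwartz)
  also have "(LINT t|lborel. ?H (Suc n) t * vderiv (?H n) t) =
      (LINT t|lborel. (of_real t * ?H n t) * ?H (Suc n) t - ?a * (?H (Suc n) t * ?H (Suc n) t))"
    unfolding v by (simp add: algebra_simps)
  also have "\<dots> = (LINT t|lborel. (of_real t * ?H n t) * ?H (Suc n) t)
      - ?a * (LINT t|lborel. ?H (Suc n) t * ?H (Suc n) t)"
    by (subst Bochner_Integration.integral_diff)
      (auto intro!: integrable_schwartz_mult tH hermite_schwartz integrable_mult_right simp del: of_real_mult)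
  also have "(LINT t|lborel. vderiv (?H (Suc n)) t * ?H n t) =
      (LINT t|lborel. ?a * (?H n t * ?H n t) - (of_real t * ?H n t) * ?H (Suc n) t)"
    unfolding v' by (simp add: algebra_simps)
  also have "\<dots> = ?a * (LINT t|lborel. ?H n t * ?H n t) - (LINT t|lborel. (of_real t * ?H n t) * ?H (Suc n) t)"
    by (subst Bochner_Integration.integral_diff)
      (auto intro!: integrable_schwartz_mult tH hermite_schwartz integrable_mult_right simp del: of_real_mult)
  finally have "?a * (LINT t|lborel. ?H (Suc n) t * ?H (Suc n) t) = ?a"
    using Suc.IH by simp
  then show ?case by (simp add: ladder_def)
qed

lemma integral_hermite_sq:
  "integrable lborel (\<lambda>t. (hermite_function n t)\<^sup>2)" "(LINT t|lborel. (hermite_function n t)\<^sup>2) = 1"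
proof -
  have *: "hermite_fun n t * hermite_fun n t = of_real ((hermite_function n t)\<^sup>2)" for t
    by (simp add: power2_eq_square)
  show "integrable lborel (\<lambda>t. (hermite_function n t)\<^sup>2)"
    using integrable_schwartz_mult[OF hermite_schwartz hermite_schwartz, of n n]
    unfolding * complex_of_real_integrable_eq .
  show "(LINT t|lborel. (hermite_function n t)\<^sup>2) = 1"
    using hermite_normalised[of n] unfolding * integral_complex_of_real by (simp only: of_real_eq_1_iff)
qed

text \<open>
  A pointwise bound that is polynomial in \<open>n\<close>. As \<open>h\<^sub>n\<close> vanishes at \<open>-\<infinity>\<close>, the value
  \<open>h\<^sub>n(t)\<^sup>2\<close> is the integral of \<open>2 h\<^sub>n h\<^sub>n'\<close> over \<open>(-\<infinity>, t]\<close>, hence at most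
  \<open>\<integral> h\<^sub>n\<^sup>2 + \<integral> h\<^sub>n'\<^sup>2\<close>, and \<open>h\<^sub>n'\<close> is a combination of two normalised functions.
\<close>

lemma hermite_sq_bound: "(hermite_function n t)\<^sup>2 \<le> 2 * real n + 2"
proof -
  let ?h = hermite_function
  let ?g = "\<lambda>t. (?h n t)\<^sup>2 + real n * (?h (n - 1) t)\<^sup>2 + real (Suc n) * (?h (Suc n) t)\<^sup>2"
  let ?h' = "\<lambda>t. ladder n * ?h (n - 1) t - ladder (Suc n) * ?h (Suc n) t"
  have g_int: "integrable lborel ?g"
    by (intro Bochner_Integration.integrable_add integrable_mult_right integral_hermite_sq)
  have g: "(LINT t|lborel. ?g t) = 2 * real n + 2"
    by (simp add: integral_hermite_sq integrable_mult_right algebra_simps)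
  \<comment> \<open>The bounds \<open>2 h h' \<le> h\<^sup>2 + h'\<^sup>2\<close> and \<open>(x - y)\<^sup>2 \<le> 2 x\<^sup>2 + 2 y\<^sup>2\<close>.\<close>
  have le: "2 * ?h n t * ?h' t \<le> ?g t" for t
  proof -
    define x y where "x = ladder n * ?h (n - 1) t" and "y = ladder (Suc n) * ?h (Suc n) t"
    have "real n * (?h (n - 1) t)\<^sup>2 = 2 * x\<^sup>2" "real (Suc n) * (?h (Suc n) t)\<^sup>2 = 2 * y\<^sup>2"
      by (simp_all add: x_def y_def power_mult_distrib power2_eq_square[of "ladder _"] ladder_sq)
    moreover have "0 \<le> (?h n t - (x - y))\<^sup>2" "0 \<le> (x + y)\<^sup>2" by simp_all
    ultimately show ?thesis
      unfolding x_def[symmetric] y_def[symmetric] by (simp add: power2_eq_square algebra_simps)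
  qed
  have cont: "isCont (?h k) t" for k t
    using hermite_function_deriv DERIV_isCont by blast
  have step: "(?h n t)\<^sup>2 - (?h n s)\<^sup>2 \<le> 2 * real n + 2" if "s \<le> t" for s
  proof -
    have *: "(\<integral>x. (2 * ?h n x * ?h' x) * indicator {s..t} x \<partial>lborel) = (?h n t)\<^sup>2 - (?h n s)\<^sup>2"
    proof (rule integral_FTC_Icc_real[OF that])
      show "((\<lambda>t. (?h n t)\<^sup>2) has_real_derivative 2 * ?h n x * ?h' x) (at x)" for x
        by (rule derivative_eq_intros hermite_function_deriv' refl | simp)+
      show "isCont (\<lambda>x. 2 * ?h n x * ?h' x) x" for x
        by (intro continuous_intros cont)
    qed
    have "continuous_on {s..t} (\<lambda>x. 2 * ?h n x * ?h' x)"
      by (intro continuous_at_imp_continuous_on ballI continuous_intros cont)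
    then have "integrable lborel (\<lambda>x. indicator {s..t} x *\<^sub>R (2 * ?h n x * ?h' x))"
      using borel_integrable_atLeastAtMost' unfolding set_integrable_def by blast
    then have "(\<integral>x. (2 * ?h n x * ?h' x) * indicator {s..t} x \<partial>lborel) \<le> (LINT t|lborel. ?g t)"
      using le by (intro integral_mono g_int) (auto simp: mult.commute split: split_indicator intro!: add_nonneg_nonneg)
    with * g show ?thesis by simp
  qed
  obtain C where C: "decay C (\<lambda>t. hermite_fun n t * hermite_fun n t)"
    using schwartz_mult_bounded_decay hermite_schwartz by metis
  have "((\<lambda>s. of_real ((?h n s)\<^sup>2) :: complex) \<longlongrightarrow> of_real 0) at_bot"
    using decay_tendsto_0(2)[OF C] by (simp add: power2_eq_square)
  then have "((\<lambda>s. (?h n s)\<^sup>2) \<longlongrightarrow> 0) at_bot" unfolding tendsto_of_real_iff .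
  then have "((\<lambda>s. (?h n t)\<^sup>2 - (?h n s)\<^sup>2) \<longlongrightarrow> (?h n t)\<^sup>2 - 0) at_bot"
    by (intro tendsto_intros)
  moreover have "eventually (\<lambda>s. (?h n t)\<^sup>2 - (?h n s)\<^sup>2 \<le> 2 * real n + 2) at_bot"
    using eventually_le_at_bot[of t] by eventually_elim (rule step)
  ultimately have "(?h n t)\<^sup>2 - 0 \<le> 2 * real n + 2"
    by (rule tendsto_upperbound) simp
  then show ?thesis by simp
qed

text \<open>
  By the recurrence each factor \<open>t\<close> costs one factor \<open>n + 1\<close>.
\<close>

lemma hermite_weighted_bound: "\<exists>K\<ge>0. \<forall>n t. \<bar>t\<bar> ^ m * \<bar>hermite_function n t\<bar> \<le> K * (real n + 1) ^ (m + 1)"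
proof (induction m)
  case 0
  have "\<bar>hermite_function n t\<bar> \<le> 2 * (real n + 1)" for n t
  proof (rule power2_le_imp_le)
    have "(hermite_function n t)\<^sup>2 \<le> 2 * real n + 2" by (rule hermite_sq_bound)
    also have "\<dots> \<le> (2 * real n + 2)\<^sup>2"
      by (rule self_le_power) auto
    finally show "\<bar>hermite_function n t\<bar>\<^sup>2 \<le> (2 * (real n + 1))\<^sup>2" by (simp add: algebra_simps)
  qed simp
  then show ?case by (intro exI[of _ 2]) auto
next
  case (Suc m)
  then obtain K where K: "K \<ge> 0" "\<And>n t. \<bar>t\<bar> ^ m * \<bar>hermite_function n t\<bar> \<le> K * (real n + 1) ^ (m + 1)"
    by auto
  have "\<bar>t\<bar> ^ Suc m * \<bar>hermite_function n t\<bar> \<le> K * (2 ^ (m + 1) + 1) * (real n + 1) ^ (Suc m + 1)" for n t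
  proof -
    have "\<bar>t\<bar> * \<bar>hermite_function n t\<bar> \<le>
        ladder (Suc n) * \<bar>hermite_function (Suc n) t\<bar> + ladder n * \<bar>hermite_function (n - 1) t\<bar>"
      unfolding abs_mult[symmetric] hermite_recurrence
      by (rule order_trans[OF abs_triangle_ineq]) (simp add: abs_mult)
    from mult_left_mono[OF this, of "\<bar>t\<bar> ^ m"]
    have "\<bar>t\<bar> ^ Suc m * \<bar>hermite_function n t\<bar> \<le>
        ladder (Suc n) * (\<bar>t\<bar> ^ m * \<bar>hermite_function (Suc n) t\<bar>) + ladder n * (\<bar>t\<bar> ^ m * \<bar>hermite_function (n - 1) t\<bar>)"
      by (simp add: algebra_simps)
    also have "\<dots> \<le> (real n + 1) * (K * (2 * (real n + 1)) ^ (m + 1)) + (real n + 1) * (K * (real n + 1) ^ (m + 1))"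
    proof (rule add_mono; rule mult_mono)
      show "ladder (Suc n) \<le> real n + 1" "ladder n \<le> real n + 1"
        using ladder_le[of n] ladder_le[of "Suc n"] by auto
      show "\<bar>t\<bar> ^ m * \<bar>hermite_function (Suc n) t\<bar> \<le> K * (2 * (real n + 1)) ^ (m + 1)"
        by (rule order_trans[OF K(2)], intro mult_left_mono power_mono) (auto simp: K(1))
      show "\<bar>t\<bar> ^ m * \<bar>hermite_function (n - 1) t\<bar> \<le> K * (real n + 1) ^ (m + 1)"
        by (rule order_trans[OF K(2)], intro mult_left_mono power_mono) (auto simp: K(1))
    qed auto
    also have "\<dots> = K * (2 ^ (m + 1) + 1) * (real n + 1) ^ (Suc m + 1)"
      unfolding power_mult_distrib by (simp add: algebra_simps)
    finally show ?thesis .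
  qed
  then show ?case using K(1) by (intro exI[of _ "K * (2 ^ (m + 1) + 1)"]) auto
qed

lemma hermite_decay: "\<exists>K\<ge>0. \<forall>n. decay (K * (real n + 1) ^ 3) (hermite_fun n)"
proof -
  obtain K L where K: "K \<ge> 0" "\<And>n t. \<bar>t\<bar> ^ 0 * \<bar>hermite_function n t\<bar> \<le> K * (real n + 1) ^ (0 + 1)"
    and L: "L \<ge> 0" "\<And>n t. \<bar>t\<bar> ^ 2 * \<bar>hermite_function n t\<bar> \<le> L * (real n + 1) ^ (2 + 1)"
    using hermite_weighted_bound by metis
  have "decay ((K + L) * (real n + 1) ^ 3) (hermite_fun n)" for n
  proof -
    have "(1 + t\<^sup>2) * \<bar>hermite_function n t\<bar> \<le> (K + L) * (real n + 1) ^ 3" for t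
    proof -
      have "\<bar>hermite_function n t\<bar> \<le> K * (real n + 1) ^ 1" using K(2)[of t n] by simp
      also have "\<dots> \<le> K * (real n + 1) ^ 3"
        using K(1) by (intro mult_left_mono power_increasing) auto
      finally have "\<bar>hermite_function n t\<bar> \<le> K * (real n + 1) ^ 3" .
      moreover have "t\<^sup>2 * \<bar>hermite_function n t\<bar> \<le> L * (real n + 1) ^ 3" using L(2)[of t n] by simp
      ultimately show ?thesis unfolding distrib_right[of _ _ "_ ^ 3"] distrib_right[of 1 "t\<^sup>2"] by simp
    qed
    then show ?thesis
      using schwartz_borel[OF hermite_schwartz] by (auto simp: decay_def field_simps)
  qed
  then show ?thesis using K(1) L(1) by (intro exI[of _ "K + L"]) auto
qed

section \<open>Completeness of the Hermite functions\<close>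

lemma integrable_bound_integral:
  fixes f :: "real \<Rightarrow> 'a::{banach, second_countable_topology}"
  assumes "integrable lborel g" "f \<in> borel_measurable lborel" "AE t in lborel. norm (f t) \<le> g t"
  shows "integrable lborel f" "norm (integral\<^sup>L lborel f) \<le> integral\<^sup>L lborel g"
proof -
  have "AE t in lborel. norm (f t) \<le> norm (g t)"
    using assms(3) by eventually_elim simp
  with assms(1,2) show int: "integrable lborel f" by (rule Bochner_Integration.integrable_bound)
  have "norm (integral\<^sup>L lborel f) \<le> (LINT t|lborel. norm (f t))" by (rule integral_norm_bound)
  also have "\<dots> \<le> integral\<^sup>L lborel g"
    using assms int by (intro integral_mono_AE) auto
  finally show "norm (integral\<^sup>L lborel f) \<le> integral\<^sup>L lborel g" .
qed

text \<open>
  The positive and the negative part of \<open>w\<close> have the same total mass, by the hypothesis at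
  \<open>s = 0\<close>. After normalisation they are densities of two probability measures with the same
  characteristic function, so Levy's uniqueness theorem identifies them; as they are never both
  positive, they vanish.
\<close>

lemma fourier_unique_real:
  fixes w :: "real \<Rightarrow> real"
  assumes w: "integrable lborel w"
    and zero: "\<And>s. (LINT t|lborel. iexp (s * t) * of_real (w t)) = 0"
  shows "AE t in lborel. w t = 0"
proof -
  have [measurable]: "w \<in> borel_measurable borel" using w by auto
  define P where "P = (\<lambda>t. max 0 (w t))"
  define N where "N = (\<lambda>t. max 0 (- w t))"
  have PN: "w t = P t - N t" "0 \<le> P t" "0 \<le> N t" for t by (auto simp: P_def N_def)
  have int: "integrable lborel P" "integrable lborel N"
    using w unfolding P_def N_def by (auto intro!: integrable_max)
  have [measurable]: "P \<in> borel_measurable borel" "N \<in> borel_measurable borel" using int by auto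
  define m where "m = (LINT t|lborel. P t)"
  have "of_real (LINT t|lborel. w t) = (0::complex)" using zero[of 0] by simp
  then have "(LINT t|lborel. P t - N t) = 0" unfolding PN(1)[symmetric] by simp
  then have mN: "(LINT t|lborel. N t) = m" using int by (simp add: m_def)
  show ?thesis
  proof (cases "m = 0")
    case True
    then have "AE t in lborel. P t = 0" "AE t in lborel. N t = 0"
      using int PN(2,3) mN integral_nonneg_eq_0_iff_AE[of lborel P] integral_nonneg_eq_0_iff_AE[of lborel N]
      by (auto simp: m_def)
    then show ?thesis by eventually_elim (simp add: PN(1))
  next
    case False
    moreover have "m \<ge> 0" unfolding m_def by (intro integral_nonneg_AE) (simp add: PN)
    ultimately have m: "m > 0" by simp
    define D where "D F = density lborel (\<lambda>t. ennreal (F t / m))" for F :: "real \<Rightarrow> real"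
    have D: "real_distribution (D F)" "\<And>s. char (D F) s = (LINT t|lborel. iexp (s * t) * of_real (F t)) / of_real m"
      if F: "integrable lborel F" "\<And>t. 0 \<le> F t" "(LINT t|lborel. F t) = m" for F
    proof -
      have [measurable]: "F \<in> borel_measurable borel" using F by auto
      have "emeasure (D F) (space (D F)) = (\<integral>\<^sup>+t. ennreal (F t / m) \<partial>lborel)"
        by (simp add: D_def emeasure_density)
      also have "\<dots> = ennreal (LINT t|lborel. F t / m)"
        using F m by (intro nn_integral_eq_integral) auto
      also have "\<dots> = 1" using F m by simp
      finally have "prob_space (D F)" by (rule prob_spaceI)
      then show "real_distribution (D F)"
        by (simp add: real_distribution_def real_distribution_axioms_def D_def)
      fix s
      have "char (D F) s = (LINT t|lborel. (F t / m) *\<^sub>R iexp (s * t))"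
        unfolding char_def D_def using F m by (intro integral_density) auto
      also have "\<dots> = (LINT t|lborel. iexp (s * t) * of_real (F t) / of_real m)"
        by (intro Bochner_Integration.integral_cong refl) (simp add: scaleR_conv_of_real)
      finally show "char (D F) s = (LINT t|lborel. iexp (s * t) * of_real (F t)) / of_real m" by simp
    qed
    note DP = D[OF int(1) PN(2) m_def[symmetric]] and DN = D[OF int(2) PN(3) mN]
    have "char (D P) = char (D N)"
    proof
      fix s
      have i: "integrable lborel (\<lambda>t. iexp (s * t) * of_real (F t))" if "integrable lborel F" for F
        by (rule Bochner_Integration.integrable_bound[OF that]) (use that in \<open>auto simp: norm_mult\<close>)
      have "0 = (LINT t|lborel. iexp (s * t) * of_real (P t) - iexp (s * t) * of_real (N t))"
        using zero[of s] unfolding PN(1) by (simp add: algebra_simps)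
      also have "\<dots> = (LINT t|lborel. iexp (s * t) * of_real (P t)) - (LINT t|lborel. iexp (s * t) * of_real (N t))"
        by (intro Bochner_Integration.integral_diff i int)
      finally show "char (D P) s = char (D N) s" unfolding DP(2) DN(2) by simp
    qed
    then have "D P = D N" by (rule Levy_uniqueness[OF DP(1) DN(1)])
    then have "AE t in lborel. ennreal (P t / m) = ennreal (N t / m)"
      unfolding D_def by (intro sigma_finite_measure.density_unique[OF lborel.sigma_finite_measure_axioms]) auto
    then show ?thesis
      by eventually_elim (use m PN in \<open>auto simp: divide_right_mono\<close>)
  qed
qed

text \<open>
  If the Fourier transform of \<open>w\<close> vanishes for all real frequencies, then so does that of the
  complex conjugate of \<open>w\<close>, hence that of the real part of \<open>w\<close>. The imaginary part is, up to
  sign, the real part of \<open>i w\<close>.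
\<close>

lemma fourier_unique:
  fixes w :: "real \<Rightarrow> complex"
  assumes w: "integrable lborel w"
    and zero: "\<And>s. (LINT t|lborel. iexp (s * t) * w t) = 0"
  shows "AE t in lborel. w t = 0"
proof -
  have Re: "AE t in lborel. Re (v t) = 0"
    if v: "integrable lborel v" and z: "\<And>s. (LINT t|lborel. iexp (s * t) * v t) = 0" for v
  proof (rule fourier_unique_real)
    show "integrable lborel (\<lambda>t. Re (v t))" using v by simp
    fix s
    have i: "integrable lborel (\<lambda>t. iexp (r * t) * v t)" for r
      by (rule Bochner_Integration.integrable_bound[OF v]) (use v in \<open>auto simp: norm_mult\<close>)
    have "(LINT t|lborel. iexp (s * t) * of_real (Re (v t))) =
      (LINT t|lborel. (iexp (s * t) * v t + cnj (iexp (- s * t) * v t)) / 2)"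
    proof (intro Bochner_Integration.integral_cong refl)
      fix t
      have "of_real (Re (v t)) = (v t + cnj (v t)) / 2" by (simp add: complex_add_cnj)
      moreover have "cnj (iexp (- s * t)) = iexp (s * t)" by (simp add: exp_cnj)
      ultimately show "iexp (s * t) * of_real (Re (v t)) = (iexp (s * t) * v t + cnj (iexp (- s * t) * v t)) / 2"
        by (simp only: complex_cnj_mult times_divide_eq_right distrib_left)
    qed
    also have "\<dots> = ((LINT t|lborel. iexp (s * t) * v t) + (LINT t|lborel. cnj (iexp (- s * t) * v t))) / 2"
      using i[of s] integrable_cnj[OF i[of "-s"]] by simp
    also have "(LINT t|lborel. cnj (iexp (- s * t) * v t)) = cnj (LINT t|lborel. iexp (- s * t) * v t)"
      by (rule Bochner_Integration.integral_cnj)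
    also have "((LINT t|lborel. iexp (s * t) * v t) + cnj (LINT t|lborel. iexp (- s * t) * v t)) / 2 = 0"
      unfolding z by simp
    finally show "(LINT t|lborel. iexp (s * t) * of_real (Re (v t))) = 0" .
  qed
  have "AE t in lborel. Re (w t) = 0" by (rule Re[OF w zero])
  moreover have "AE t in lborel. Re (\<i> * w t) = 0"
  proof (rule Re)
    show "integrable lborel (\<lambda>t. \<i> * w t)" using w by simp
    show "(LINT t|lborel. iexp (s * t) * (\<i> * w t)) = 0" for s
      using zero[of s] unfolding mult.left_commute[of "iexp _"] by simp
  qed
  ultimately show ?thesis by eventually_elim (simp add: complex_eq_iff)
qed

lemma integrable_weight_times_decay:
  fixes u g :: "real \<Rightarrow> complex"
  assumes u: "integrable lborel (\<lambda>t. u t / of_real (1 + t\<^sup>2))" and [measurable]: "u \<in> borel_measurable borel"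
    and g: "decay C g"
  shows "integrable lborel (\<lambda>t. u t * g t)"
proof (rule integrable_bound_integral(1))
  have [measurable]: "g \<in> borel_measurable borel" using g by (simp add: decay_def)
  show "integrable lborel (\<lambda>t. C * norm (u t / of_real (1 + t\<^sup>2)))"
    by (intro integrable_mult_right integrable_norm u)
  show "(\<lambda>t. u t * g t) \<in> borel_measurable lborel" by measurable
  have "norm (u t * g t) \<le> norm (u t) * (C / (1 + t\<^sup>2))" for t
    unfolding norm_mult using g by (intro mult_left_mono) (auto simp: decay_def)
  then show "AE t in lborel. norm (u t * g t) \<le> C * norm (u t / of_real (1 + t\<^sup>2))"
    by (simp add: norm_divide mult_ac norm_of_real abs_of_pos del: of_real_add)
qed

lemma exp_partial_sum_bound:
  fixes z :: complex
  shows "norm (\<Sum>k<n. z ^ k /\<^sub>R fact k) \<le> exp (norm z)"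
proof -
  have "norm (\<Sum>k<n. z ^ k /\<^sub>R fact k) \<le> (\<Sum>k<n. norm z ^ k /\<^sub>R fact k)"
    by (rule sum_norm_le) (simp add: norm_power)
  also have "\<dots> \<le> exp (norm z)"
    unfolding exp_def by (intro sum_le_suminf summable_exp_generic) auto
  finally show ?thesis .
qed

text \<open>
  The left-hand side dominates the partial sums of the exponential series of \<open>i s t\<close> times the
  Gaussian; it still has quadratic decay because \<open>|s t| \<le> s\<^sup>2 + t\<^sup>2/4\<close>.
\<close>

lemma exp_times_gauss_le:
  fixes s t :: real
  shows "exp (\<bar>s * t\<bar>) * exp (- (t\<^sup>2) / 2) \<le> 4 * exp (s\<^sup>2) / (1 + t\<^sup>2)"
proof -
  have "0 \<le> (\<bar>s\<bar> - \<bar>t\<bar> / 2)\<^sup>2" by simp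
  then have "\<bar>s * t\<bar> - t\<^sup>2 / 2 \<le> s\<^sup>2 - t\<^sup>2 / 4"
    by (simp add: power2_diff power_divide abs_mult)
  then have "exp (\<bar>s * t\<bar>) * exp (- (t\<^sup>2) / 2) \<le> exp (s\<^sup>2 - t\<^sup>2 / 4)"
    by (simp add: exp_add[symmetric])
  also have "\<dots> = exp (s\<^sup>2) / exp (t\<^sup>2 / 4)" by (simp add: exp_diff)
  also have "\<dots> \<le> exp (s\<^sup>2) / ((1 + t\<^sup>2) / 4)"
  proof (intro divide_left_mono)
    have "(1 + t\<^sup>2) / 4 \<le> 1 + t\<^sup>2 / 4" by simp
    also have "\<dots> \<le> exp (t\<^sup>2 / 4)" by (rule exp_ge_add_one_self)
    finally show "(1 + t\<^sup>2) / 4 \<le> exp (t\<^sup>2 / 4)" .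
  qed auto
  finally show ?thesis by (simp add: mult.commute)
qed

lemma schwartz_times_power: "f \<in> schwartz_space \<Longrightarrow> (\<lambda>t. of_real t ^ k * f t) \<in> schwartz_space"
proof (induction k)
  case (Suc k)
  then show ?case using schwartz_times_id[OF Suc.IH] by (simp add: mult_ac)
qed simp

text \<open>
  Multiplication by \<open>t\<close> maps the span of the Hermite functions to itself, so \<open>u\<close> is orthogonal
  to all \<open>t\<^sup>k h\<^sub>0\<close>. Thus all moments of \<open>w = u exp (-t\<^sup>2/2)\<close> vanish, and by dominated
  convergence so does the integral of \<open>w\<close> against \<open>exp (i s t)\<close>, summed termwise.
\<close>

lemma hermite_complete_weight:
  assumes u: "integrable lborel (\<lambda>t. u t / of_real (1 + t\<^sup>2))" and [measurable]: "u \<in> borel_measurable borel"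
    and zero: "\<And>n. (LINT t|lborel. u t * hermite_fun n t) = 0"
  shows "AE t in lborel. u t = 0"
proof -
  have int: "integrable lborel (\<lambda>t. u t * g t)" if "g \<in> schwartz_space" for g
    by (rule schwartz_decay[OF that]) (rule integrable_weight_times_decay[OF u assms(2)])
  have pow: "(LINT t|lborel. u t * (of_real t ^ k * hermite_fun n t)) = 0" for k n
  proof (induction k arbitrary: n)
    case (Suc k)
    let ?I = "\<lambda>n t. u t * (of_real t ^ k * hermite_fun n t)"
    have i: "integrable lborel (?I n)" for n
      by (intro int schwartz_times_power hermite_schwartz)
    have "u t * (of_real t ^ Suc k * hermite_fun n t) =
        of_real (ladder (Suc n)) * ?I (Suc n) t + of_real (ladder n) * ?I (n - 1) t" for t
    proof -
      have "of_real t * hermite_fun n t =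
          of_real (ladder (Suc n)) * hermite_fun (Suc n) t + of_real (ladder n) * hermite_fun (n - 1) t"
        unfolding of_real_mult[symmetric] of_real_add[symmetric] hermite_recurrence ..
      then have "u t * (of_real t ^ k * (of_real t * hermite_fun n t)) =
        u t * (of_real t ^ k * (of_real (ladder (Suc n)) * hermite_fun (Suc n) t + of_real (ladder n) * hermite_fun (n - 1) t))"
        by simp
      then show ?thesis by (simp add: algebra_simps)
    qed
    then have "(LINT t|lborel. u t * (of_real t ^ Suc k * hermite_fun n t)) =
        of_real (ladder (Suc n)) * (LINT t|lborel. ?I (Suc n) t) + of_real (ladder n) * (LINT t|lborel. ?I (n - 1) t)"
      using i by (simp only: integrable_mult_right Bochner_Integration.integral_add integral_mult_right_zero)
    then show ?case unfolding Suc.IH by simp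
  qed (simp add: zero)
  define w where "w t = u t * of_real (exp (- (t\<^sup>2) / 2))" for t
  have [measurable]: "w \<in> borel_measurable borel" unfolding w_def by measurable
  have h0: "hermite_fun 0 t = of_real (hermite_norm_const 0) * of_real (exp (- (t\<^sup>2) / 2))" for t
    by (simp add: hermite_function_poly)
  have c0: "hermite_norm_const 0 \<noteq> 0" by (simp add: hermite_norm_const_def)
  have w_int: "integrable lborel (\<lambda>t. of_real t ^ k * w t)" for k
  proof -
    have "integrable lborel (\<lambda>t. of_real (1 / hermite_norm_const 0) * (u t * (of_real t ^ k * hermite_fun 0 t)))"
      by (intro integrable_mult_right int schwartz_times_power hermite_schwartz)
    then show ?thesis unfolding h0 w_def using c0 by (simp add: mult_ac)
  qed
  have moment: "(LINT t|lborel. of_real t ^ k * w t) = 0" for k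
  proof -
    have "(LINT t|lborel. u t * (of_real t ^ k * hermite_fun 0 t)) =
      of_real (hermite_norm_const 0) * (LINT t|lborel. of_real t ^ k * w t)"
      unfolding integral_mult_right_zero[symmetric] h0 w_def by (simp add: mult_ac)
    then show ?thesis using pow[of k 0] c0 by simp
  qed
  have "AE t in lborel. w t = 0"
  proof (rule fourier_unique)
    show "integrable lborel w" using w_int[of 0] by simp
    fix s
    let ?S = "\<lambda>n t. (\<Sum>k<n. (\<i> * of_real (s * t)) ^ k /\<^sub>R fact k) * w t"
    have "(\<lambda>n. LINT t|lborel. ?S n t) \<longlonglongrightarrow> (LINT t|lborel. iexp (s * t) * w t)"
    proof (rule integral_dominated_convergence)
      show "integrable lborel (\<lambda>t. 4 * exp (s\<^sup>2) * norm (u t / of_real (1 + t\<^sup>2)))"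
        by (intro integrable_mult_right integrable_norm u)
      show "AE t in lborel. (\<lambda>n. ?S n t) \<longlonglongrightarrow> iexp (s * t) * w t"
        using exp_converges[of "\<i> * of_real (s * _)"] unfolding sums_def
        by (intro AE_I2 tendsto_mult tendsto_const)
      have "norm (?S n t) \<le> 4 * exp (s\<^sup>2) * norm (u t / of_real (1 + t\<^sup>2))" for n t
      proof -
        have "norm (?S n t) \<le> exp (\<bar>s * t\<bar>) * norm (w t)"
          unfolding norm_mult[of _ "w t"]
          by (rule mult_right_mono[OF order_trans[OF exp_partial_sum_bound]]) (auto simp: norm_mult abs_mult)
        also have "\<dots> = (exp (\<bar>s * t\<bar>) * exp (- (t\<^sup>2) / 2)) * norm (u t)"
          by (simp add: w_def norm_mult)
        also have "\<dots> \<le> (4 * exp (s\<^sup>2) / (1 + t\<^sup>2)) * norm (u t)"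
          by (intro mult_right_mono exp_times_gauss_le) auto
        also have "\<dots> = 4 * exp (s\<^sup>2) * norm (u t / of_real (1 + t\<^sup>2))"
          by (simp add: norm_divide norm_of_real abs_of_pos del: of_real_add)
        finally show ?thesis .
      qed
      then show "AE t in lborel. norm (?S n t) \<le> 4 * exp (s\<^sup>2) * norm (u t / of_real (1 + t\<^sup>2))" for n
        by (intro AE_I2)
    qed measurable
    moreover have "(LINT t|lborel. ?S n t) = 0" for n
    proof -
      have "?S n t = (\<Sum>k<n. ((\<i> * of_real s) ^ k /\<^sub>R fact k) * (of_real t ^ k * w t))" for t
        unfolding sum_distrib_right by (intro sum.cong refl) (simp add: power_mult_distrib mult_ac)
      then have "(LINT t|lborel. ?S n t) = (\<Sum>k<n. LINT t|lborel. ((\<i> * of_real s) ^ k /\<^sub>R fact k) * (of_real t ^ k * w t))"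
        by (simp only: Bochner_Integration.integral_sum integrable_mult_right w_int)
      also have "\<dots> = 0" by (simp only: integral_mult_right_zero moment) simp
      finally show ?thesis .
    qed
    ultimately show "(LINT t|lborel. iexp (s * t) * w t) = 0"
      by (simp add: LIMSEQ_const_iff)
  qed
  then show ?thesis by eventually_elim (simp add: w_def)
qed

section \<open>Hermite series with rapidly decreasing coefficients\<close>

definition rapidly_decreasing :: "(nat \<Rightarrow> complex) \<Rightarrow> bool" where
  "rapidly_decreasing c \<longleftrightarrow> (\<forall>k. \<exists>C. \<forall>n. norm (c n) * (real n + 1) ^ k \<le> C)"

text \<open>
  Summability with any polynomial weight is gained from two further powers of \<open>n + 1\<close>.
\<close>

lemma rapidly_decreasing_summable:
  assumes "rapidly_decreasing c"
  shows "summable (\<lambda>n. norm (c n) * (real n + 1) ^ k)"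
proof -
  obtain C where C: "\<And>n. norm (c n) * (real n + 1) ^ (k + 2) \<le> C"
    using assms unfolding rapidly_decreasing_def by meson
  show ?thesis
  proof (rule summable_comparison_test')
    show "summable (\<lambda>n. C * inverse (real (Suc n) ^ 2))"
      using inverse_power_summable[of 2, where 'a = real] summable_Suc_iff[of "\<lambda>n. inverse (real n ^ 2)"]
      by (intro summable_mult) auto
    fix n
    have "norm (c n) * (real n + 1) ^ k = norm (c n) * (real n + 1) ^ (k + 2) * inverse ((real n + 1) ^ 2)"
    proof -
      have "(real n + 1) ^ 2 * inverse ((real n + 1) ^ 2) = 1" by (rule right_inverse) simp
      then show ?thesis by (simp only: power_add mult.assoc mult_1_right)
    qed
    also have "\<dots> \<le> C * inverse ((real n + 1) ^ 2)"
      by (intro mult_right_mono C) auto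
    finally show "norm (norm (c n) * (real n + 1) ^ k) \<le> C * inverse (real (Suc n) ^ 2)"
      by (simp add: add.commute)
  qed
qed

lemma rapidly_decreasing_mult:
  assumes "rapidly_decreasing c" "\<And>n. norm (d n) \<le> B * norm (c n) * (real n + 1) ^ j" "0 \<le> B"
  shows "rapidly_decreasing d"
  unfolding rapidly_decreasing_def
proof
  fix k
  obtain C where C: "\<And>n. norm (c n) * (real n + 1) ^ (j + k) \<le> C"
    using assms(1) unfolding rapidly_decreasing_def by meson
  have "norm (d n) * (real n + 1) ^ k \<le> B * C" for n
  proof -
    have "norm (d n) * (real n + 1) ^ k \<le> (B * norm (c n) * (real n + 1) ^ j) * (real n + 1) ^ k"
      by (intro mult_right_mono assms) auto
    also have "\<dots> = B * (norm (c n) * (real n + 1) ^ (j + k))" by (simp add: power_add)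
    also have "\<dots> \<le> B * C" by (intro mult_left_mono C assms)
    finally show ?thesis .
  qed
  then show "\<exists>C. \<forall>n. norm (d n) * (real n + 1) ^ k \<le> C" by blast
qed

lemma rapidly_decreasing_add:
  assumes "rapidly_decreasing c" "rapidly_decreasing d"
  shows "rapidly_decreasing (\<lambda>n. c n + d n)"
  unfolding rapidly_decreasing_def
proof
  fix k
  obtain C D where "\<And>n. norm (c n) * (real n + 1) ^ k \<le> C" "\<And>n. norm (d n) * (real n + 1) ^ k \<le> D"
    using assms unfolding rapidly_decreasing_def by meson
  then have "norm (c n + d n) * (real n + 1) ^ k \<le> C + D" for n
    using mult_right_mono[OF norm_triangle_ineq[of "c n" "d n"], of "(real n + 1) ^ k"]
      add_mono[of "norm (c n) * (real n + 1) ^ k" C "norm (d n) * (real n + 1) ^ k" D]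
    by (simp add: distrib_right)
  then show "\<exists>C. \<forall>n. norm (c n + d n) * (real n + 1) ^ k \<le> C" by blast
qed

lemma rapidly_decreasing_shift:
  assumes "rapidly_decreasing c"
  shows "rapidly_decreasing (\<lambda>n. of_real (ladder (Suc n)) * c (Suc n))"
    and "rapidly_decreasing (\<lambda>n. of_real (ladder n) * c (n - 1))"
proof -
  have "rapidly_decreasing (\<lambda>n. c (Suc n))"
    unfolding rapidly_decreasing_def
  proof
    fix k
    obtain C where C: "\<And>n. norm (c n) * (real n + 1) ^ k \<le> C"
      using assms unfolding rapidly_decreasing_def by meson
    have "norm (c (Suc n)) * (real n + 1) ^ k \<le> C" for n
      by (rule order_trans[OF _ C[of "Suc n"]]) (intro mult_left_mono power_mono; simp)
    then show "\<exists>C. \<forall>n. norm (c (Suc n)) * (real n + 1) ^ k \<le> C" by blast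
  qed
  then show "rapidly_decreasing (\<lambda>n. of_real (ladder (Suc n)) * c (Suc n))"
  proof (rule rapidly_decreasing_mult[where B = 1 and j = 1])
    show "norm (of_real (ladder (Suc n)) * c (Suc n)) \<le> 1 * norm (c (Suc n)) * (real n + 1) ^ 1" for n
      using mult_right_mono[OF ladder_le[of "Suc n"], of "norm (c (Suc n))"]
      by (simp add: norm_mult mult_ac add.commute)
  qed simp
  have "rapidly_decreasing (\<lambda>n. c (n - 1))"
    unfolding rapidly_decreasing_def
  proof
    fix k
    obtain C where C: "\<And>n. norm (c n) * (real n + 1) ^ k \<le> C"
      using assms unfolding rapidly_decreasing_def by meson
    have "norm (c (n - 1)) * (real n + 1) ^ k \<le> 2 ^ k * C" for n
    proof -
      have "(real n + 1) ^ k \<le> (2 * (real (n - 1) + 1)) ^ k"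
        by (intro power_mono) (cases n; simp)+
      then have "norm (c (n - 1)) * (real n + 1) ^ k \<le> norm (c (n - 1)) * (2 * (real (n - 1) + 1)) ^ k"
        by (rule mult_left_mono) simp
      also have "\<dots> = 2 ^ k * (norm (c (n - 1)) * (real (n - 1) + 1) ^ k)"
        unfolding power_mult_distrib by simp
      also have "\<dots> \<le> 2 ^ k * C" by (intro mult_left_mono C) auto
      finally show ?thesis .
    qed
    then show "\<exists>C. \<forall>n. norm (c (n - 1)) * (real n + 1) ^ k \<le> C" by blast
  qed
  then show "rapidly_decreasing (\<lambda>n. of_real (ladder n) * c (n - 1))"
  proof (rule rapidly_decreasing_mult[where B = 1 and j = 1])
    show "norm (of_real (ladder n) * c (n - 1)) \<le> 1 * norm (c (n - 1)) * (real n + 1) ^ 1" for n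
      using mult_right_mono[OF order_trans[OF ladder_le[of n], of "real n + 1"], of "norm (c (n - 1))"]
      by (simp add: norm_mult mult_ac)
  qed simp
qed

text \<open>
  A constant that witnesses \<open>hermite_decay\<close> for all \<open>n\<close> simultaneously, chosen once so that the
  weights below depend on \<open>n\<close> only.
\<close>

definition hermite_const :: real where
  "hermite_const = (SOME K. 0 \<le> K \<and> (\<forall>n. decay (K * (real n + 1) ^ 3) (hermite_fun n)))"

definition hermite_weight :: "nat \<Rightarrow> real" where
  "hermite_weight n = hermite_const * (real n + 1) ^ 3"

lemma hermite_const_nonneg: "0 \<le> hermite_const"
  and hermite_fun_decay: "decay (hermite_weight n) (hermite_fun n)"
proof -
  have "\<exists>K\<ge>0. \<forall>n. decay (K * (real n + 1) ^ 3) (hermite_fun n)" by (rule hermite_decay)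
  from someI_ex[OF this]
  show "0 \<le> hermite_const" "decay (hermite_weight n) (hermite_fun n)"
    by (auto simp: hermite_const_def hermite_weight_def)
qed

lemma hermite_weight_nonneg: "0 \<le> hermite_weight n"
  using hermite_const_nonneg by (simp add: hermite_weight_def)

definition hermite_series :: "(nat \<Rightarrow> complex) \<Rightarrow> real \<Rightarrow> complex" where
  "hermite_series c t = (\<Sum>n. c n * hermite_fun n t)"

lemma summable_hermite_weight:
  assumes "rapidly_decreasing c"
  shows "summable (\<lambda>n. norm (c n) * hermite_weight n)"
  using summable_mult[OF rapidly_decreasing_summable[OF assms, of 3], of hermite_const]
  by (simp add: hermite_weight_def mult_ac)

lemma hermite_series_term_le: "norm (c n * hermite_fun n t) \<le> norm (c n) * hermite_weight n"
  unfolding norm_mult using decay_le[OF hermite_fun_decay, of n t] by (intro mult_left_mono) auto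

lemma hermite_series_sums:
  assumes "rapidly_decreasing c"
  shows "summable (\<lambda>n. norm (c n * hermite_fun n t))"
    and "(\<lambda>n. c n * hermite_fun n t) sums hermite_series c t"
proof -
  show *: "summable (\<lambda>n. norm (c n * hermite_fun n t))"
    by (rule summable_comparison_test'[OF summable_hermite_weight[OF assms]])
      (use hermite_series_term_le in auto)
  show "(\<lambda>n. c n * hermite_fun n t) sums hermite_series c t"
    unfolding hermite_series_def by (rule summable_sums[OF summable_norm_cancel[OF *]])
qed

text \<open>
  The weights \<open>hermite_weight n\<close> turn absolute convergence of coefficients into a pointwise bound
  with quadratic decay, and thereby into a bound in every \<open>L\<^sup>p\<close>.
\<close>

lemma hermite_series_decay:
  assumes "summable (\<lambda>n. norm (c n) * hermite_weight n)"
  shows "decay (\<Sum>n. norm (c n) * hermite_weight n) (hermite_series c)"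
  unfolding decay_def
proof (intro conjI allI)
  have [measurable]: "hermite_fun n \<in> borel_measurable borel" for n
    by (rule schwartz_borel[OF hermite_schwartz])
  show "hermite_series c \<in> borel_measurable borel"
    unfolding hermite_series_def[abs_def] by measurable
  fix t
  have le: "norm (c n * hermite_fun n t) \<le> norm (c n) * hermite_weight n / (1 + t\<^sup>2)" for n
    using mult_left_mono[of "norm (hermite_fun n t)" "hermite_weight n / (1 + t\<^sup>2)" "norm (c n)"] hermite_fun_decay[of n]
    by (simp add: norm_mult decay_def)
  have s: "summable (\<lambda>n. norm (c n) * hermite_weight n / (1 + t\<^sup>2))"
    using assms by (rule summable_divide)
  have "norm (hermite_series c t) \<le> (\<Sum>n. norm (c n) * hermite_weight n / (1 + t\<^sup>2))"
    unfolding hermite_series_def by (rule norm_suminf_le[OF le s])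
  also have "\<dots> = (\<Sum>n. norm (c n) * hermite_weight n) / (1 + t\<^sup>2)"
    by (rule suminf_divide[OF assms])
  finally show "norm (hermite_series c t) \<le> (\<Sum>n. norm (c n) * hermite_weight n) / (1 + t\<^sup>2)" .
qed

text \<open>
  Reindexing: the series of \<open>c\<^sub>n\<close> with \<open>h\<^sub>n\<close> replaced by a neighbour of \<open>h\<^sub>n\<close> is again a Hermite
  series. No boundary term arises, because \<open>ladder 0 = 0\<close>.
\<close>

lemma hermite_series_lower:
  assumes "rapidly_decreasing c"
  shows "(\<lambda>n. c n * of_real (ladder n * hermite_function (n - 1) t)) sums
      hermite_series (\<lambda>n. of_real (ladder (Suc n)) * c (Suc n)) t"
proof -
  let ?f = "\<lambda>n. c n * of_real (ladder n * hermite_function (n - 1) t)"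
  have "(\<lambda>n. ?f (Suc n)) sums hermite_series (\<lambda>n. of_real (ladder (Suc n)) * c (Suc n)) t"
    using hermite_series_sums(2)[OF rapidly_decreasing_shift(1)[OF assms], of t] by (simp add: mult_ac)
  from sums_Suc[OF this] show ?thesis by simp
qed

lemma hermite_series_raise:
  assumes "rapidly_decreasing c"
  shows "(\<lambda>n. c n * of_real (ladder (Suc n) * hermite_function (Suc n) t)) sums
      hermite_series (\<lambda>n. of_real (ladder n) * c (n - 1)) t"
proof -
  let ?f = "\<lambda>n. of_real (ladder n) * c (n - 1) * hermite_fun n t"
  have "?f sums (hermite_series (\<lambda>n. of_real (ladder n) * c (n - 1)) t + ?f 0)"
    using hermite_series_sums(2)[OF rapidly_decreasing_shift(2)[OF assms], of t] by simp
  then have "(\<lambda>n. ?f (Suc n)) sums hermite_series (\<lambda>n. of_real (ladder n) * c (n - 1)) t"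
    by (rule sums_Suc_iff[of ?f, THEN iffD2])
  then show ?thesis by (simp add: mult_ac)
qed

lemma hermite_series_diff:
  assumes "rapidly_decreasing c" "rapidly_decreasing d"
  shows "hermite_series (\<lambda>n. c n - d n) t = hermite_series c t - hermite_series d t"
  using sums_diff[OF hermite_series_sums(2)[OF assms(1)] hermite_series_sums(2)[OF assms(2)]]
  by (simp add: hermite_series_def sums_iff left_diff_distrib)

lemma hermite_series_cmult:
  assumes "rapidly_decreasing c"
  shows "hermite_series (\<lambda>n. k * c n) t = k * hermite_series c t"
  using sums_mult[OF hermite_series_sums(2)[OF assms], of k]
  by (simp add: hermite_series_def sums_iff mult.assoc)

lemma hermite_series_times_id:
  assumes "rapidly_decreasing c"
  shows "\<exists>d. rapidly_decreasing d \<and> (\<forall>t. of_real t * hermite_series c t = hermite_series d t)"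
proof (intro exI conjI allI)
  let ?l = "\<lambda>n. of_real (ladder (Suc n)) * c (Suc n)" and ?r = "\<lambda>n. of_real (ladder n) * c (n - 1)"
  let ?d = "\<lambda>n. ?l n + ?r n"
  note lr = rapidly_decreasing_shift[OF assms]
  show d: "rapidly_decreasing ?d" by (intro rapidly_decreasing_add lr)
  fix t
  have 1: "(\<lambda>n. of_real t * (c n * hermite_fun n t)) sums (hermite_series ?r t + hermite_series ?l t)"
  proof -
    have "of_real t * (c n * hermite_fun n t) = c n * of_real (ladder (Suc n) * hermite_function (Suc n) t)
        + c n * of_real (ladder n * hermite_function (n - 1) t)" for n
      using arg_cong[OF hermite_recurrence[of t n], of "\<lambda>x. c n * of_real x"]
      by (simp add: algebra_simps)
    then show ?thesis using sums_add[OF hermite_series_raise[OF assms] hermite_series_lower[OF assms]] by simp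
  qed
  have 2: "(\<lambda>n. of_real t * (c n * hermite_fun n t)) sums (of_real t * hermite_series c t)"
    by (intro sums_mult hermite_series_sums assms)
  have 3: "(\<lambda>n. ?d n * hermite_fun n t) sums (hermite_series ?l t + hermite_series ?r t)"
    using sums_add[OF hermite_series_sums(2)[OF lr(1)] hermite_series_sums(2)[OF lr(2)]]
    by (simp add: distrib_right)
  show "of_real t * hermite_series c t = hermite_series ?d t"
    using sums_unique2[OF 1 2] sums_unique2[OF 3 hermite_series_sums(2)[OF d]] by (simp only: add.commute)
qed

text \<open>
Termwise differentiation, with the uniform convergence supplied by the Weierstrass M-test.
\<close>

lemma has_vector_derivative_series:
  fixes f f' :: "nat \<Rightarrow> real \<Rightarrow> complex"
  assumes deriv: "\<And>n t. (f n has_vector_derivative f' n t) (at t)"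
    and bound: "\<And>n t. norm (f' n t) \<le> M n" and M: "summable M"
    and sums: "\<And>t. (\<lambda>n. f n t) sums F t" "\<And>t. (\<lambda>n. f' n t) sums F' t"
  shows "(F has_vector_derivative F' t) (at t)"
proof -
  have lim: "uniform_limit UNIV (\<lambda>n t. \<Sum>i<n. f' i t) (\<lambda>t. \<Sum>i. f' i t) sequentially"
    by (rule Weierstrass_m_test[OF bound M])
  have F': "(\<Sum>i. f' i t) = F' t" for t using sums(2) sums_iff by blast
  have "\<exists>g. \<forall>x\<in>UNIV. (\<lambda>n. f n x) sums g x \<and> (g has_derivative (\<lambda>h. h *\<^sub>R F' x)) (at x within UNIV)"
  proof (rule has_derivative_series)
    show "(f n has_derivative (\<lambda>h. h *\<^sub>R f' n x)) (at x within UNIV)" for n x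
      using deriv by (simp add: has_vector_derivative_def)
    fix e :: real assume "e > 0"
    then have "\<forall>\<^sub>F n in sequentially. \<forall>t. norm ((\<Sum>i<n. f' i t) - F' t) < e"
      using lim unfolding uniform_limit_iff dist_norm F' by simp
    then show "\<forall>\<^sub>F n in sequentially. \<forall>x\<in>UNIV. \<forall>h. norm ((\<Sum>i<n. h *\<^sub>R f' i x) - h *\<^sub>R F' x) \<le> e * norm h"
    proof eventually_elim
      case (elim n)
      have "norm ((\<Sum>i<n. h *\<^sub>R f' i x) - h *\<^sub>R F' x) = norm h * norm ((\<Sum>i<n. f' i x) - F' x)" for x h
        unfolding scaleR_sum_right[symmetric] scaleR_diff_right[symmetric] by simp
      moreover have "norm h * norm ((\<Sum>i<n. f' i x) - F' x) \<le> norm h * e" for x and h :: real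
        using elim by (intro mult_left_mono) (auto simp: less_imp_le)
      ultimately show ?case by (simp add: mult.commute[of e])
    qed
  qed (use sums(1)[of 0] in auto)
  then obtain g where g: "\<And>x. (\<lambda>n. f n x) sums g x" "\<And>x. (g has_vector_derivative F' x) (at x)"
    by (auto simp: has_vector_derivative_def)
  have "g = F" by (rule ext) (rule sums_unique2[OF g(1) sums(1)])
  with g(2) show ?thesis by simp
qed

lemma hermite_series_deriv:
  assumes "rapidly_decreasing c"
  shows "\<exists>d. rapidly_decreasing d \<and> (\<forall>t. (hermite_series c has_vector_derivative hermite_series d t) (at t))"
proof (intro exI conjI allI)
  let ?l = "\<lambda>n. of_real (ladder (Suc n)) * c (Suc n)" and ?r = "\<lambda>n. of_real (ladder n) * c (n - 1)"
  let ?d = "\<lambda>n. ?l n + (- 1) * ?r n"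
  note lr = rapidly_decreasing_shift[OF assms]
  have r': "rapidly_decreasing (\<lambda>n. (- 1) * ?r n)"
    by (rule rapidly_decreasing_mult[OF lr(2), of _ 1 0]) auto
  show d: "rapidly_decreasing ?d" by (intro rapidly_decreasing_add lr r')
  fix t
  show "(hermite_series c has_vector_derivative hermite_series ?d t) (at t)"
  proof (rule has_vector_derivative_series)
    let ?f' = "\<lambda>n t. c n * of_real (ladder n * hermite_function (n - 1) t - ladder (Suc n) * hermite_function (Suc n) t)"
    show "((\<lambda>t. c n * hermite_fun n t) has_vector_derivative ?f' n t) (at t)" for n t
      by (intro has_vector_derivative_mult_right hermite_fun_has_vderiv)
    show "(\<lambda>n. c n * hermite_fun n t) sums hermite_series c t" for t
      by (rule hermite_series_sums[OF assms])
    show "(\<lambda>n. ?f' n t) sums hermite_series ?d t" for t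
    proof -
      have 1: "(\<lambda>n. ?f' n t) sums (hermite_series ?l t - hermite_series ?r t)"
        using sums_diff[OF hermite_series_lower[OF assms] hermite_series_raise[OF assms], of t]
        by (simp add: algebra_simps)
      have 2: "(\<lambda>n. ?d n * hermite_fun n t) sums (hermite_series ?l t - hermite_series ?r t)"
        using sums_diff[OF hermite_series_sums(2)[OF lr(1)] hermite_series_sums(2)[OF lr(2)]]
        by (simp add: algebra_simps)
      show ?thesis
        using 1 unfolding sums_unique2[OF 2 hermite_series_sums(2)[OF d]] .
    qed
    let ?M = "\<lambda>n. 9 * hermite_const * (norm (c n) * (real n + 1) ^ 4)"
    show "summable ?M" by (intro summable_mult rapidly_decreasing_summable assms)
    fix n t
    have "\<bar>ladder n * hermite_function (n - 1) t - ladder (Suc n) * hermite_function (Suc n) t\<bar>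
       \<le> ladder n * \<bar>hermite_function (n - 1) t\<bar> + ladder (Suc n) * \<bar>hermite_function (Suc n) t\<bar>"
      by (rule order_trans[OF abs_triangle_ineq4]) (simp add: abs_mult)
    also have "\<dots> \<le> (real n + 1) * (hermite_const * (real n + 1) ^ 3) + (real n + 1) * (hermite_const * (2 * (real n + 1)) ^ 3)"
    proof (rule add_mono; rule mult_mono)
      show "ladder (Suc n) \<le> real n + 1" "ladder n \<le> real n + 1"
        using ladder_le[of n] ladder_le[of "Suc n"] by auto
      have h: "\<bar>hermite_function m t\<bar> \<le> hermite_const * (real m + 1) ^ 3" for m
        using decay_le[OF hermite_fun_decay, of m t] by (simp add: hermite_weight_def)
      show "\<bar>hermite_function (n - 1) t\<bar> \<le> hermite_const * (real n + 1) ^ 3"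
        "\<bar>hermite_function (Suc n) t\<bar> \<le> hermite_const * (2 * (real n + 1)) ^ 3"
        by (rule order_trans[OF h], intro mult_left_mono power_mono; simp add: hermite_const_nonneg)+
    qed auto
    also have "\<dots> = 9 * hermite_const * (real n + 1) ^ 4"
      unfolding power_mult_distrib by (simp add: eval_nat_numeral)
    finally have "norm (?f' n t) \<le> norm (c n) * (9 * hermite_const * (real n + 1) ^ 4)"
      unfolding norm_mult norm_of_real by (rule mult_left_mono) simp
    then show "norm (?f' n t) \<le> ?M n" by (simp add: mult_ac)
  qed
qed

text \<open>
  The set of all Hermite series with rapidly decreasing coefficients is closed under \<open>d/dt\<close> and
  under multiplication by \<open>t\<close>, and its members are bounded.
\<close>

lemma hermite_series_schwartz:
  assumes "rapidly_decreasing c"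
  shows "hermite_series c \<in> schwartz_space"
proof (rule schwartz_coinduct)
  let ?A = "{hermite_series c | c. rapidly_decreasing c}"
  show "hermite_series c \<in> ?A" using assms by blast
  fix k assume "k \<in> ?A"
  then obtain c where k: "k = hermite_series c" and c: "rapidly_decreasing c" by blast
  show "\<exists>k'\<in>?A. \<forall>t. (k has_vector_derivative k' t) (at t)"
    using hermite_series_deriv[OF c] unfolding k by blast
  fix m
  show "\<exists>C. \<forall>t. \<bar>t\<bar> ^ m * norm (k t) \<le> C"
    unfolding k using c
  proof (induction m arbitrary: c)
    case 0
    then show ?case
      using decay_le[OF hermite_series_decay[OF summable_hermite_weight]] by auto
  next
    case (Suc m)
    obtain d where d: "rapidly_decreasing d" "\<And>t. of_real t * hermite_series c t = hermite_series d t"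
      using hermite_series_times_id[OF Suc.prems] by blast
    have "\<bar>t\<bar> ^ Suc m * norm (hermite_series c t) = \<bar>t\<bar> ^ m * norm (hermite_series d t)" for t
      unfolding d(2)[symmetric] by (simp add: norm_mult)
    then show ?case using Suc.IH[OF d(1)] by (simp only:)
  qed
qed

section \<open>The Hermite transform on Schwartz functions\<close>

lemma hermite_transform_series:
  assumes c: "rapidly_decreasing c"
  shows "hermite_transform (hermite_series c) m = c m"
proof -
  let ?f = "\<lambda>n t. c n * (hermite_fun n t * hermite_fun m t)"
  have i: "integrable lborel (?f n)" for n
    by (intro integrable_mult_right integrable_schwartz_mult hermite_schwartz)
  have le: "norm (?f n t) \<le> norm (c n) * hermite_weight n * norm (hermite_fun m t)" for n t
    using mult_right_mono[OF hermite_series_term_le[of c n t], of "norm (hermite_fun m t)"]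
    by (simp add: norm_mult mult.assoc)
  have s: "summable (\<lambda>n. norm (c n) * hermite_weight n)" by (rule summable_hermite_weight[OF c])
  have "hermite_transform (hermite_series c) m = (LINT t|lborel. (\<Sum>n. ?f n t))"
    unfolding hermite_transform_def
  proof (intro Bochner_Integration.integral_cong refl)
    fix t
    have "(\<lambda>n. c n * hermite_fun n t * hermite_fun m t) sums (hermite_series c t * hermite_fun m t)"
      by (intro sums_mult2 hermite_series_sums c)
    then show "hermite_series c t * of_real (hermite_function m t) = (\<Sum>n. ?f n t)"
      by (simp add: sums_iff mult.assoc)
  qed
  also have "\<dots> = (\<Sum>n. LINT t|lborel. ?f n t)"
  proof (rule integral_suminf[OF i])
    show "AE t in lborel. summable (\<lambda>n. norm (?f n t))"
      by (intro AE_I2 summable_comparison_test'[OF summable_mult2[OF s]]) (use le in auto)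
    show "summable (\<lambda>n. LINT t|lborel. norm (?f n t))"
    proof (rule summable_comparison_test'[OF summable_mult2[OF s, of "LINT t|lborel. norm (hermite_fun m t)"]])
      fix n
      have "(LINT t|lborel. norm (?f n t)) \<le> (LINT t|lborel. norm (c n) * hermite_weight n * norm (hermite_fun m t))"
        using integrable_schwartz[OF hermite_schwartz, of m]
        by (intro integral_mono integrable_norm i integrable_mult_right le)
      then show "norm (LINT t|lborel. norm (?f n t)) \<le> norm (c n) * hermite_weight n * (LINT t|lborel. norm (hermite_fun m t))"
        by (simp only: integral_mult_right_zero) simp
    qed
  qed
  also have "\<dots> = (\<Sum>n. if n = m then c m else 0)"
  proof (rule arg_cong[where f = suminf], rule ext)
    fix n
    show "(LINT t|lborel. ?f n t) = (if n = m then c m else 0)"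
      unfolding integral_mult_right_zero using hermite_orthogonal[of n m] hermite_normalised[of m] by auto
  qed
  also have "\<dots> = c m" using suminf_finite[of "{m}" "\<lambda>n. if n = m then c m else 0"] by simp
  finally show ?thesis .
qed

lemma hermite_transform_diff:
  assumes "f \<in> schwartz_space" "g \<in> schwartz_space"
  shows "hermite_transform (\<lambda>t. f t - g t) n = hermite_transform f n - hermite_transform g n"
  unfolding hermite_transform_def left_diff_distrib
  by (intro Bochner_Integration.integral_diff integrable_schwartz_mult hermite_schwartz assms)

lemma hermite_transform_cmult: "hermite_transform (\<lambda>t. k * f t) n = k * hermite_transform f n"
  unfolding hermite_transform_def mult.assoc by (rule integral_mult_right_zero)

lemma hermite_transform_hermite_diff:
  assumes "f \<in> schwartz_space"
  shows "hermite_transform (hermite_diff f) n = - (2 * of_nat n + 1) * hermite_transform f n"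
proof -
  have "hermite_transform (hermite_diff f) n = (LINT t|lborel. f t * hermite_diff (hermite_fun n) t)"
    unfolding hermite_transform_def by (intro hermite_diff_symmetric assms hermite_schwartz)
  also have "\<dots> = - (2 * of_nat n + 1) * (LINT t|lborel. f t * hermite_fun n t)"
    unfolding hermite_eigenfunction mult.left_commute[of "f _"] by (rule integral_mult_right_zero)
  finally show ?thesis by (simp add: hermite_transform_def)
qed

lemma schwartz_hermite_diff_power: "f \<in> schwartz_space \<Longrightarrow> (hermite_diff ^^ k) f \<in> schwartz_space"
  by (induction k) (auto intro: schwartz_hermite_diff)

lemma hermite_transform_hermite_diff_power:
  assumes "f \<in> schwartz_space"
  shows "hermite_transform ((hermite_diff ^^ k) f) n = (- (2 * of_nat n + 1)) ^ k * hermite_transform f n"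
  by (induction k)
    (simp_all add: hermite_transform_hermite_diff schwartz_hermite_diff_power assms del: minus_add_distrib)

lemma norm_hermite_eigenvalue: "norm (- (2 * of_nat n + 1) :: complex) = 2 * real n + 1"
  using norm_of_nat[of "2 * n + 1", where 'a = complex] unfolding norm_minus_cancel by (simp add: add.commute)

text \<open>
  \<open>(2n+1)\<^sup>j |\<F>f(n)|\<close> is the modulus of the \<open>n\<close>-th coefficient of \<open>T\<^sup>j f\<close>, which is at most
  \<open>(n+1)\<^sup>3\<close> times a constant that depends on \<open>T\<^sup>j f\<close> only.
\<close>

lemma hermite_transform_rapidly_decreasing:
  assumes f: "f \<in> schwartz_space"
  shows "rapidly_decreasing (hermite_transform f)"
  unfolding rapidly_decreasing_def
proof
  fix k
  \<comment> \<open>The three additional powers absorb the factor \<open>(n+1)\<^sup>3\<close> of \<open>hermite_weight\<close>.\<close>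
  let ?g = "(hermite_diff ^^ (k + 3)) f"
  let ?C = "hermite_const * (LINT t|lborel. norm (?g t))"
  have g: "?g \<in> schwartz_space" by (rule schwartz_hermite_diff_power[OF f])
  have "norm (hermite_transform f n) * (real n + 1) ^ k \<le> ?C" for n
  proof -
    have "norm (hermite_transform f n) * (real n + 1) ^ (k + 3) \<le> norm (hermite_transform f n) * (2 * real n + 1) ^ (k + 3)"
      by (intro mult_left_mono power_mono) auto
    also have "\<dots> = norm (hermite_transform ?g n)"
      unfolding hermite_transform_hermite_diff_power[OF f] norm_mult norm_power norm_hermite_eigenvalue
      by (rule mult.commute)
    also have "\<dots> \<le> (LINT t|lborel. hermite_weight n * norm (?g t))"
      unfolding hermite_transform_def
    proof (rule integrable_bound_integral(2))
      show "integrable lborel (\<lambda>t. hermite_weight n * norm (?g t))"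
        by (intro integrable_mult_right integrable_norm integrable_schwartz g)
      show "(\<lambda>t. ?g t * hermite_fun n t) \<in> borel_measurable lborel"
        using integrable_schwartz_mult[OF g hermite_schwartz] by auto
      show "AE t in lborel. norm (?g t * hermite_fun n t) \<le> hermite_weight n * norm (?g t)"
        using decay_le[OF hermite_fun_decay, of n]
        by (intro AE_I2) (simp add: norm_mult mult.commute mult_right_mono)
    qed
    also have "\<dots> = ?C * (real n + 1) ^ 3" by (simp add: hermite_weight_def)
    finally have "(norm (hermite_transform f n) * (real n + 1) ^ k) * (real n + 1) ^ 3 \<le> ?C * (real n + 1) ^ 3"
      by (simp add: power_add mult.assoc)
    then show ?thesis by (rule mult_right_le_imp_le) simp
  qed
  then show "\<exists>C. \<forall>n. norm (hermite_transform f n) * (real n + 1) ^ k \<le> C" by blast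
qed

lemma schwartz_class_eqI:
  assumes f: "f \<in> schwartz_space" and g: "g \<in> schwartz_space"
    and eq: "\<And>n. hermite_transform f n = hermite_transform g n"
  shows "aeclass f = aeclass g"
proof -
  let ?u = "\<lambda>t. f t - g t"
  have u: "?u \<in> schwartz_space" by (rule schwartz_diff[OF f g])
  have [measurable]: "?u \<in> borel_measurable borel" by (rule schwartz_borel[OF u])
  have "AE t in lborel. ?u t = 0"
  proof (rule hermite_complete_weight)
    show "integrable lborel (\<lambda>t. ?u t / of_real (1 + t\<^sup>2))"
    proof (rule Bochner_Integration.integrable_bound[OF integrable_schwartz[OF u]])
      show "AE t in lborel. norm (?u t / of_real (1 + t\<^sup>2)) \<le> norm (?u t)"
        by (intro AE_I2) (simp add: norm_divide norm_of_real divide_le_eq mult_le_cancel_left1 del: of_real_add)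
    qed measurable
    show "?u \<in> borel_measurable borel" by measurable
    show "(LINT t|lborel. ?u t * hermite_fun n t) = 0" for n
      using hermite_transform_diff[OF f g, of n] eq[of n] by (simp add: hermite_transform_def)
  qed
  then have "AE t in lborel. fun_of (aeclass f) t = fun_of (aeclass g) t"
    using fun_of_aeclass[OF schwartz_borel[OF f]] fun_of_aeclass[OF schwartz_borel[OF g]]
    by eventually_elim simp
  then show ?thesis by (simp add: aefun_eq_iff)
qed

section \<open>Coefficients of classes in \<open>L\<^sup>p\<close>\<close>

lemma aeclass_fun_of [simp]: "aeclass (fun_of u) = u"
  by (rule Quotient_abs_rep[OF Quotient_aefun])

lemma aeclass_diff:
  "f \<in> borel_measurable borel \<Longrightarrow> g \<in> borel_measurable borel \<Longrightarrow>
    aeclass f - aeclass g = aeclass (\<lambda>t. f t - g t)"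
  by (rule minus_aefun.abs_eq) auto

lemma aeclass_scale: "f \<in> borel_measurable borel \<Longrightarrow> c *\<^sub>a aeclass f = aeclass (\<lambda>t. c * f t)"
  by (rule scale_ae.abs_eq) auto

lemma fun_of_diff: "AE t in lborel. fun_of (u - v) t = fun_of u t - fun_of v t"
proof -
  have [measurable]: "fun_of u \<in> borel_measurable borel" "fun_of v \<in> borel_measurable borel"
    by (rule fun_of_measurable)+
  have "u - v = aeclass (\<lambda>t. fun_of u t - fun_of v t)"
    using aeclass_diff[of "fun_of u" "fun_of v"] by simp
  then show ?thesis using fun_of_aeclass[of "\<lambda>t. fun_of u t - fun_of v t"] by simp
qed

lemma fun_of_scale: "AE t in lborel. fun_of (c *\<^sub>a u) t = c * fun_of u t"
proof -
  have [measurable]: "fun_of u \<in> borel_measurable borel" by (rule fun_of_measurable)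
  have "c *\<^sub>a u = aeclass (\<lambda>t. c * fun_of u t)"
    using aeclass_scale[of "fun_of u" c] by simp
  then show ?thesis using fun_of_aeclass[of "\<lambda>t. c * fun_of u t"] by simp
qed

lemma Lp_exponent_cases:
  assumes "1 \<le> p"
  obtains "p = \<infinity>" | "p \<noteq> \<infinity>" "1 \<le> enn2real p"
proof (cases "p = \<infinity>")
  case False
  then have "1 \<le> enn2real p"
    using assms enn2real_mono[of 1 p] by (simp add: top.not_eq_extremum)
  with False show ?thesis by (rule that(2))
qed (rule that(1))

lemma Lp_infinity_AE:
  assumes "u \<in> Lp \<infinity>"
  shows "AE t in lborel. norm (fun_of u t) \<le> Lp_norm \<infinity> u"
proof -
  let ?e = "esssup lborel (\<lambda>t. ennreal (norm (fun_of u t)))"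
  have "?e < \<infinity>" using assms by (simp add: Lp_def in_Lp.rep_eq)
  then have e: "ennreal (enn2real ?e) = ?e" by simp
  have "AE t in lborel. ennreal (norm (fun_of u t)) \<le> ?e" by (rule esssup_AE)
  then show ?thesis
  proof eventually_elim
    case (elim t)
    then have "ennreal (norm (fun_of u t)) \<le> ennreal (enn2real ?e)" unfolding e .
    then show ?case by (simp add: Lp_norm.rep_eq)
  qed
qed

lemma Lp_infinityI:
  assumes "AE t in lborel. norm (fun_of u t) \<le> M"
  shows "u \<in> Lp \<infinity>"
proof -
  have [measurable]: "fun_of u \<in> borel_measurable borel" by (rule fun_of_measurable)
  have "esssup lborel (\<lambda>t. ennreal (norm (fun_of u t))) \<le> ennreal M"
  proof (rule esssup_I)
    show "AE t in lborel. ennreal (norm (fun_of u t)) \<le> ennreal M"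
      using assms by eventually_elim (rule ennreal_leI)
  qed measurable
  then show ?thesis by (simp add: Lp_def in_Lp.rep_eq le_less_trans)
qed

lemma Lp_finite_iff:
  "p \<noteq> \<infinity> \<Longrightarrow> u \<in> Lp p \<longleftrightarrow> integrable lborel (\<lambda>t. norm (fun_of u t) powr enn2real p)"
  by (simp add: Lp_def in_Lp.rep_eq)

lemma Lp_scale:
  assumes "u \<in> Lp p"
  shows "c *\<^sub>a u \<in> Lp p"
proof (cases "p = \<infinity>")
  case True
  have "AE t in lborel. norm (fun_of (c *\<^sub>a u) t) \<le> norm c * Lp_norm \<infinity> u"
    using Lp_infinity_AE[OF assms[unfolded True]] fun_of_scale[of c u]
    by eventually_elim (auto simp: norm_mult intro: mult_left_mono)
  then show ?thesis unfolding True by (rule Lp_infinityI)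
next
  case False
  have [measurable]: "fun_of v \<in> borel_measurable borel" for v by (rule fun_of_measurable)
  have "integrable lborel (\<lambda>t. norm c powr enn2real p * norm (fun_of u t) powr enn2real p)"
    using assms unfolding Lp_finite_iff[OF False] by (rule integrable_mult_right)
  moreover have "AE t in lborel. norm c powr enn2real p * norm (fun_of u t) powr enn2real p
      = norm (fun_of (c *\<^sub>a u) t) powr enn2real p"
    using fun_of_scale[of c u] by eventually_elim (simp add: norm_mult powr_mult)
  ultimately show ?thesis
    unfolding Lp_finite_iff[OF False] by (subst (asm) integrable_cong_AE) auto
qed

lemma Lp_diff:
  assumes p: "1 \<le> p" and uv: "u \<in> Lp p" "v \<in> Lp p"
  shows "u - v \<in> Lp p"
  using p
proof (cases rule: Lp_exponent_cases)
  case 1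
  have "AE t in lborel. norm (fun_of (u - v) t) \<le> Lp_norm \<infinity> u + Lp_norm \<infinity> v"
    using Lp_infinity_AE[OF uv(1)[unfolded 1]] Lp_infinity_AE[OF uv(2)[unfolded 1]] fun_of_diff[of u v]
  proof eventually_elim
    case (elim t)
    then show ?case using norm_triangle_ineq4[of "fun_of u t" "fun_of v t"] by simp
  qed
  then show ?thesis unfolding 1 by (rule Lp_infinityI)
next
  case 2
  let ?q = "enn2real p"
  have [measurable]: "fun_of v \<in> borel_measurable borel" for v by (rule fun_of_measurable)
  show ?thesis unfolding Lp_finite_iff[OF 2(1)]
  proof (rule integrable_bound_integral(1))
    show "integrable lborel (\<lambda>t. 2 powr ?q * (norm (fun_of u t) powr ?q + norm (fun_of v t) powr ?q))"
      using uv unfolding Lp_finite_iff[OF 2(1)]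
      by (intro integrable_mult_right Bochner_Integration.integrable_add)
    show "AE t in lborel. norm (norm (fun_of (u - v) t) powr ?q)
        \<le> 2 powr ?q * (norm (fun_of u t) powr ?q + norm (fun_of v t) powr ?q)"
      using fun_of_diff[of u v]
    proof eventually_elim
      case (elim t)
      let ?m = "max (norm (fun_of u t)) (norm (fun_of v t))"
      have "norm (fun_of (u - v) t) \<le> 2 * ?m"
        using elim norm_triangle_ineq4[of "fun_of u t" "fun_of v t"] by simp
      then have "norm (fun_of (u - v) t) powr ?q \<le> (2 * ?m) powr ?q"
        using 2(2) by (intro powr_mono2) auto
      also have "\<dots> = 2 powr ?q * ?m powr ?q" by (rule powr_mult)
      also have "\<dots> \<le> 2 powr ?q * (norm (fun_of u t) powr ?q + norm (fun_of v t) powr ?q)"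
        by (intro mult_left_mono) (auto simp: max_def)
      finally show ?case by simp
    qed
  qed measurable
qed

text \<open>
  For \<open>p < \<infinity>\<close> and \<open>\<parallel>u\<parallel>\<^sub>p = 1\<close>, the inequality \<open>x \<le> 1 + x\<^sup>p\<close> bounds \<open>|u g|\<close> by
  \<open>C (1 / (1 + t\<^sup>2) + |u|\<^sup>p)\<close>, whose integral is \<open>C (\<pi> + 1)\<close>. The general case follows by scaling.
\<close>

lemma Lp_pairing:
  assumes p: "1 \<le> p" and u: "u \<in> Lp p" and g: "decay C g"
  shows "integrable lborel (\<lambda>t. fun_of u t * g t)"
    and "norm (LINT t|lborel. fun_of u t * g t) \<le> C * (pi + 1) * Lp_norm p u"
proof -
  have [measurable]: "fun_of u \<in> borel_measurable borel" by (rule fun_of_measurable)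
  have [measurable]: "g \<in> borel_measurable borel" using g by (simp add: decay_def)
  have C: "C \<ge> 0" by (rule decay_nonneg[OF g])
  have m: "(\<lambda>t. fun_of u t * g t) \<in> borel_measurable lborel" by measurable
  let ?k = "\<lambda>t::real. 1 / (1 + t\<^sup>2)"
  have gk: "norm (g t) \<le> C * ?k t" for t using g by (simp add: decay_def)
  have *: "integrable lborel (\<lambda>t. fun_of u t * g t) \<and>
      norm (LINT t|lborel. fun_of u t * g t) \<le> C * (pi + 1) * Lp_norm p u"
    using p
  proof (cases rule: Lp_exponent_cases)
    case 1
    let ?M = "Lp_norm p u"
    have M: "?M \<ge> 0" unfolding 1 Lp_norm.rep_eq by simp
    have int: "integrable lborel (\<lambda>t. ?M * C * ?k t)"
      by (intro integrable_mult_right integrable_inverse_one_plus_sq)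
    have "AE t in lborel. norm (fun_of u t * g t) \<le> ?M * C * ?k t"
      using Lp_infinity_AE[OF u[unfolded 1]] unfolding 1[symmetric]
    proof eventually_elim
      case (elim t)
      then have "norm (fun_of u t * g t) \<le> ?M * (C * ?k t)"
        unfolding norm_mult using gk M by (intro mult_mono) auto
      then show ?case by (simp only: mult.assoc)
    qed
    note b = integrable_bound_integral[OF int _ this]
    have "?M * C * pi \<le> C * (pi + 1) * ?M"
      using mult_nonneg_nonneg[OF C M] by (simp add: algebra_simps)
    then show ?thesis using b by (simp add: integral_inverse_one_plus_sq del: times_divide_eq_right)
  next
    case 2
    let ?q = "enn2real p" and ?N = "Lp_norm p u"
    let ?I = "LINT t|lborel. norm (fun_of u t) powr ?q"
    have q: "?q \<ge> 1" by (rule 2(2))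
    have I: "integrable lborel (\<lambda>t. norm (fun_of u t) powr ?q)"
      using u unfolding Lp_finite_iff[OF 2(1)] .
    have N: "?N = ?I powr (1 / ?q)" using 2(1) by (simp add: Lp_norm.rep_eq)
    have I0: "?I \<ge> 0" by (intro integral_nonneg_AE) auto
    show ?thesis
    proof (cases "?I = 0")
      case True
      then have "AE t in lborel. norm (fun_of u t) powr ?q = 0"
        using integral_nonneg_eq_0_iff_AE[OF I] by simp
      then have ae: "AE t in lborel. fun_of u t * g t = 0" by eventually_elim simp
      then have "integrable lborel (\<lambda>t. fun_of u t * g t)"
        by (subst integrable_cong_AE[where g = "\<lambda>_. 0"]) auto
      moreover have "(LINT t|lborel. fun_of u t * g t) = 0"
        using ae by (subst integral_cong_AE[where g = "\<lambda>_. 0"]) auto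
      ultimately show ?thesis using C by (simp add: N)
    next
      case False
      then have N0: "?N > 0" "?I > 0" using I0 by (simp_all add: N order.strict_iff_order eq_commute[of 0])
      have NI: "?N powr ?q = ?I" using q I0 by (simp add: N powr_powr)
      have int: "integrable lborel (\<lambda>t. (?N * C) * (?k t + norm (fun_of u t) powr ?q / ?I))"
        using I integrable_inverse_one_plus_sq by auto
      have "norm (fun_of u t * g t) \<le> (?N * C) * (?k t + norm (fun_of u t) powr ?q / ?I)" for t
      proof -
        \<comment> \<open>The value of \<open>|u|\<close> after normalising \<open>u\<close>; then \<open>x\<^sup>q\<close> is \<open>|u|\<^sup>q\<close> divided by its integral.\<close>
        define x where "x = norm (fun_of u t) / ?N"
        have x: "x \<ge> 0" using N0 by (simp add: x_def)
        have k: "?k t \<le> 1" by (simp add: divide_le_eq)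
        have "x * ?k t \<le> ?k t + x powr ?q"
        proof (cases "x \<le> 1")
          case True
          then have "x * ?k t \<le> 1 * ?k t" by (intro mult_right_mono) auto
          then show ?thesis using powr_ge_zero[of x ?q] by linarith
        next
          case False
          then have "x * ?k t \<le> x * 1" using k by (intro mult_left_mono) auto
          also have "\<dots> \<le> x powr ?q" using False q powr_mono[of 1 ?q x] by simp
          finally show ?thesis by (simp add: add_increasing)
        qed
        from mult_left_mono[OF this, of "?N * C"] C N0
        have "(?N * C) * (x * ?k t) \<le> (?N * C) * (?k t + x powr ?q)" by simp
        moreover have "norm (fun_of u t * g t) \<le> (?N * C) * (x * ?k t)"
        proof -
          have "norm (fun_of u t * g t) \<le> norm (fun_of u t) * (C * ?k t)"
            unfolding norm_mult by (intro mult_left_mono gk) simp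
          also have "\<dots> = (?N * C) * (x * ?k t)" using N0 by (simp add: x_def)
          finally show ?thesis .
        qed
        moreover have "x powr ?q = norm (fun_of u t) powr ?q / ?I"
          unfolding x_def NI[symmetric] by (rule powr_divide)
        ultimately show ?thesis by simp
      qed
      then have "AE t in lborel. norm (fun_of u t * g t) \<le> (?N * C) * (?k t + norm (fun_of u t) powr ?q / ?I)"
        by simp
      note b = integrable_bound_integral[OF int _ this]
      have "(LINT t|lborel. ?k t + norm (fun_of u t) powr ?q / ?I) = pi + 1"
        by (subst Bochner_Integration.integral_add)
          (use I integrable_inverse_one_plus_sq N0 in \<open>auto simp: integral_inverse_one_plus_sq\<close>)
      then have "(LINT t|lborel. (?N * C) * (?k t + norm (fun_of u t) powr ?q / ?I)) = (?N * C) * (pi + 1)"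
        unfolding integral_mult_right_zero by (rule arg_cong)
      also have "\<dots> = C * (pi + 1) * ?N" by (simp add: mult_ac)
      finally have "norm (LINT t|lborel. fun_of u t * g t) \<le> C * (pi + 1) * ?N"
        using b(2)[OF m] by (simp only:)
      with b(1)[OF m] show ?thesis by (rule conjI)
    qed
  qed
  show "integrable lborel (\<lambda>t. fun_of u t * g t)" using * by simp
  show "norm (LINT t|lborel. fun_of u t * g t) \<le> C * (pi + 1) * Lp_norm p u" using * by simp
qed

lemma Lp_norm_decay_le:
  assumes p: "1 \<le> p" and f: "decay C f"
  shows "Lp_norm p (aeclass f) \<le> pi * C"
proof -
  have [measurable]: "f \<in> borel_measurable borel" using f by (simp add: decay_def)
  have C: "C \<ge> 0" by (rule decay_nonneg[OF f])
  show ?thesis using p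
  proof (cases rule: Lp_exponent_cases)
    case 1
    have "esssup lborel (\<lambda>t. ennreal (norm (f t))) \<le> ennreal C"
      by (rule esssup_I) (auto intro!: ennreal_leI decay_le[OF f])
    then have "Lp_norm p (aeclass f) \<le> C"
      using C by (simp add: 1 Lp_norm.abs_eq enn2real_leI)
    also have "\<dots> \<le> pi * C" using C pi_ge_two by (simp add: mult_le_cancel_right1)
    finally show ?thesis .
  next
    case 2
    let ?q = "enn2real p" and ?k = "\<lambda>t::real. 1 / (1 + t\<^sup>2)"
    have int: "integrable lborel (\<lambda>t. C powr ?q * ?k t)"
      by (intro integrable_mult_right integrable_inverse_one_plus_sq)
    have "norm (f t) powr ?q \<le> C powr ?q * ?k t" for t
    proof -
      have "norm (f t) \<le> C * ?k t" using f by (simp add: decay_def)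
      then have "norm (f t) powr ?q \<le> (C * ?k t) powr ?q"
        using 2(2) by (intro powr_mono2) auto
      also have "\<dots> = C powr ?q * ?k t powr ?q" by (rule powr_mult)
      also have "?k t powr ?q \<le> ?k t"
        using 2(2) by (intro powr_le_one_le) auto
      finally show ?thesis by (simp add: mult_left_mono)
    qed
    then have "(LINT t|lborel. norm (f t) powr ?q) \<le> (LINT t|lborel. C powr ?q * ?k t)"
      by (intro integral_mono integrable_bound_integral(1)[OF int] int) auto
    also have "\<dots> = C powr ?q * pi"
      by (simp add: integral_inverse_one_plus_sq del: times_divide_eq_right)
    finally have "(LINT t|lborel. norm (f t) powr ?q) powr (1 / ?q) \<le> (C powr ?q * pi) powr (1 / ?q)"
      using 2(2) by (intro powr_mono2) (auto intro!: integral_nonneg_AE)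
    also have "\<dots> = C * pi powr (1 / ?q)"
      using 2(2) C by (simp add: powr_mult powr_powr)
    also have "\<dots> \<le> C * pi powr 1"
      using 2(2) C pi_ge_two by (intro mult_left_mono powr_mono) (auto simp: divide_le_eq)
    finally show ?thesis using 2(1) by (simp add: Lp_norm.abs_eq mult.commute)
  qed
qed

definition hermite_coeff :: "aefun \<Rightarrow> nat \<Rightarrow> complex" where
  "hermite_coeff u n = (LINT t|lborel. fun_of u t * hermite_fun n t)"

lemma hermite_coeff_aeclass:
  assumes [measurable]: "f \<in> borel_measurable borel"
  shows "hermite_coeff (aeclass f) n = hermite_transform f n"
proof -
  have [measurable]: "fun_of v \<in> borel_measurable borel" for v by (rule fun_of_measurable)
  have [measurable]: "hermite_fun n \<in> borel_measurable borel" by (rule schwartz_borel[OF hermite_schwartz])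
  show ?thesis unfolding hermite_coeff_def hermite_transform_def
  proof (rule integral_cong_AE)
    show "AE t in lborel. fun_of (aeclass f) t * hermite_fun n t = f t * hermite_fun n t"
      using fun_of_aeclass[OF assms] by eventually_elim simp
  qed measurable
qed

lemma hermite_coeff_zero: "hermite_coeff 0 n = 0"
  using hermite_coeff_aeclass[of "\<lambda>_. 0" n] by (simp add: zero_aefun_def hermite_transform_def)

lemma hermite_coeff_scale: "hermite_coeff (c *\<^sub>a u) n = c * hermite_coeff u n"
proof -
  have [measurable]: "fun_of v \<in> borel_measurable borel" for v by (rule fun_of_measurable)
  have "hermite_coeff (c *\<^sub>a u) n = hermite_transform (\<lambda>t. c * fun_of u t) n"
    using aeclass_scale[of "fun_of u" c] by (simp add: hermite_coeff_aeclass[symmetric])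
  then show ?thesis by (simp add: hermite_transform_cmult) (simp add: hermite_coeff_def hermite_transform_def)
qed

lemma hermite_coeff_diff:
  assumes "1 \<le> p" "u \<in> Lp p" "v \<in> Lp p"
  shows "hermite_coeff (u - v) n = hermite_coeff u n - hermite_coeff v n"
proof -
  have [measurable]: "fun_of v \<in> borel_measurable borel" for v by (rule fun_of_measurable)
  have "hermite_coeff (u - v) n = hermite_transform (\<lambda>t. fun_of u t - fun_of v t) n"
    using aeclass_diff[of "fun_of u" "fun_of v"] by (simp add: hermite_coeff_aeclass[symmetric])
  also have "\<dots> = (LINT t|lborel. fun_of u t * hermite_fun n t - fun_of v t * hermite_fun n t)"
    by (simp add: hermite_transform_def left_diff_distrib)
  also have "\<dots> = hermite_coeff u n - hermite_coeff v n"
    unfolding hermite_coeff_def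
    by (intro Bochner_Integration.integral_diff Lp_pairing(1)[OF assms(1) _ hermite_fun_decay] assms)
  finally show ?thesis .
qed

lemma hermite_coeff_bound:
  assumes "1 \<le> p" "u \<in> Lp p"
  shows "norm (hermite_coeff u n) \<le> hermite_weight n * (pi + 1) * Lp_norm p u"
  unfolding hermite_coeff_def by (rule Lp_pairing(2)[OF assms hermite_fun_decay])

text \<open>
  In \<open>L\<^sup>p\<close> the hypothesis of \<open>hermite_complete_weight\<close> on integrability holds, since
  \<open>1 / (1 + t\<^sup>2)\<close> itself can be paired with \<open>u\<close>.
\<close>

lemma hermite_complete:
  assumes p: "1 \<le> p" and u: "u \<in> Lp p" and zero: "\<And>n. hermite_coeff u n = 0"
  shows "u = 0"
proof -
  have [measurable]: "fun_of u \<in> borel_measurable borel" by (rule fun_of_measurable)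
  have "AE t in lborel. fun_of u t = 0"
  proof (rule hermite_complete_weight)
    have "decay 1 (\<lambda>t. 1 / of_real (1 + t\<^sup>2))"
      unfolding decay_def by (auto simp: norm_divide norm_of_real simp del: of_real_add)
    from Lp_pairing(1)[OF p u this]
    show "integrable lborel (\<lambda>t. fun_of u t / of_real (1 + t\<^sup>2))" by simp
    show "(LINT t|lborel. fun_of u t * hermite_fun n t) = 0" for n
      using zero[of n] by (simp add: hermite_coeff_def)
  qed measurable
  moreover have "AE t in lborel. fun_of 0 t = 0"
    unfolding zero_aefun_def by (rule fun_of_aeclass) simp
  ultimately have "AE t in lborel. fun_of u t = fun_of 0 t" by eventually_elim simp
  then show ?thesis by (simp add: aefun_eq_iff)
qed

text \<open>
  A coefficient is a bounded functional, so applied to \<open>\<phi>\<close> it gives a differentiable, hence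
  continuous, scalar function.
\<close>

lemma analytic_hermite_coeff_tendsto:
  assumes p: "1 \<le> p" and U: "open U" "z \<in> U" and \<phi>: "analytic_Lp p \<phi> U"
  shows "((\<lambda>w. hermite_coeff (\<phi> w) n) \<longlongrightarrow> hermite_coeff (\<phi> z) n) (at z)"
proof -
  have L: "\<phi> w \<in> Lp p" if "w \<in> U" for w using \<phi> that by (simp add: analytic_Lp_def)
  obtain d where d: "d \<in> Lp p"
    and lim: "((\<lambda>w. Lp_norm p (inverse (w - z) *\<^sub>a (\<phi> w - \<phi> z) - d)) \<longlongrightarrow> 0) (at z)"
    using \<phi> U by (auto simp: analytic_Lp_def)
  have U': "\<forall>\<^sub>F w in at z. w \<in> U \<and> w \<noteq> z"
    using eventually_at_in_open[OF U] by (simp add: eventually_mono)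
  \<comment> \<open>The error of the difference quotient tends to zero in norm, hence so do its coefficients.\<close>
  let ?Q = "\<lambda>w. inverse (w - z) *\<^sub>a (\<phi> w - \<phi> z) - d"
  have Q: "((\<lambda>w. hermite_coeff (?Q w) n) \<longlongrightarrow> 0) (at z)"
  proof (rule Lim_null_comparison)
    show "((\<lambda>w. hermite_weight n * (pi + 1) * Lp_norm p (?Q w)) \<longlongrightarrow> 0) (at z)"
      using tendsto_mult_left[OF lim, of "hermite_weight n * (pi + 1)"] by simp
    show "\<forall>\<^sub>F w in at z. norm (hermite_coeff (?Q w) n) \<le> hermite_weight n * (pi + 1) * Lp_norm p (?Q w)"
      using U'
    proof eventually_elim
      case (elim w)
      then have "w \<in> U" by simp
      then show ?case by (intro hermite_coeff_bound[OF p] Lp_diff[OF p] Lp_scale L d U(2))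
    qed
  qed
  have "((\<lambda>w. hermite_coeff (\<phi> z) n + (w - z) * (hermite_coeff (?Q w) n + hermite_coeff d n))
      \<longlongrightarrow> hermite_coeff (\<phi> z) n + (z - z) * (0 + hermite_coeff d n)) (at z)"
    by (intro tendsto_intros Q)
  then have "((\<lambda>w. hermite_coeff (\<phi> z) n + (w - z) * (hermite_coeff (?Q w) n + hermite_coeff d n))
      \<longlongrightarrow> hermite_coeff (\<phi> z) n) (at z)" by simp
  moreover have "\<forall>\<^sub>F w in at z. hermite_coeff (\<phi> z) n + (w - z) * (hermite_coeff (?Q w) n + hermite_coeff d n)
      = hermite_coeff (\<phi> w) n"
    using U'
  proof eventually_elim
    case (elim w)
    have eq: "hermite_coeff (?Q w) n = inverse (w - z) * (hermite_coeff (\<phi> w) n - hermite_coeff (\<phi> z) n) - hermite_coeff d n"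
      using elim U(2) d by (simp add: hermite_coeff_diff[OF p] hermite_coeff_scale L Lp_scale Lp_diff[OF p])
    have cancel: "k * (inverse k * x) = x" if "k \<noteq> 0" for k x :: complex using that by simp
    have "w - z \<noteq> 0" using elim by simp
    from cancel[OF this] show ?case by (simp only: eq diff_add_cancel) simp
  qed
  ultimately show ?thesis by (rule Lim_transform_eventually)
qed

section \<open>Operators between the Hermite operator and its maximal extension\<close>

lemma op_apply_eqI: "single_valued S \<Longrightarrow> (x, y) \<in> S \<Longrightarrow> op_apply S x = y"
  unfolding op_apply_def by (auto dest: single_valuedD)

lemma op_apply_in: "single_valued S \<Longrightarrow> x \<in> Domain S \<Longrightarrow> (x, op_apply S x) \<in> S"
  using op_apply_eqI[of S x] by blast

lemma maximal_hermite_coeff: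
  assumes "(u, v) \<in> maximal_hermite_operator p"
  shows "hermite_coeff v n = - (2 * of_nat n + 1) * hermite_coeff u n"
proof -
  have "hermite_coeff v n = (LINT t|lborel. fun_of u t * hermite_diff (hermite_fun n) t)"
    using assms hermite_schwartz[of n] by (auto simp: maximal_hermite_operator_def hermite_coeff_def)
  also have "\<dots> = - (2 * of_nat n + 1) * hermite_coeff u n"
    unfolding hermite_eigenfunction hermite_coeff_def mult.left_commute[of "fun_of u _"]
    by (rule integral_mult_right_zero)
  finally show ?thesis .
qed

text \<open>
  The scalar form of \<open>(T - z) x = y\<close>. It yields both the single-valued extension property
  (\<open>y = 0\<close>) and the points that the local spectrum must contain (\<open>y = f\<close>).
\<close>

lemma resolvent_hermite_coeff:
  assumes "1 \<le> p" "T \<subseteq> maximal_hermite_operator p" "single_valued T" "x \<in> Domain T"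
    and "op_apply T x - z *\<^sub>a x = y"
  shows "(- (2 * of_nat n + 1) - z) * hermite_coeff x n = hermite_coeff y n"
proof -
  have xv: "(x, op_apply T x) \<in> maximal_hermite_operator p"
    using op_apply_in assms by blast
  then have "x \<in> Lp p" "op_apply T x \<in> Lp p" by (auto simp: maximal_hermite_operator_def)
  then have "hermite_coeff y n = hermite_coeff (op_apply T x) n - z * hermite_coeff x n"
    unfolding assms(5)[symmetric] using assms(1) by (simp add: hermite_coeff_diff Lp_scale hermite_coeff_scale)
  then show ?thesis unfolding maximal_hermite_coeff[OF xv] by (simp add: algebra_simps)
qed

text \<open>
  For \<open>z\<close> different from \<open>-(2n+1)\<close> the \<open>n\<close>-th coefficient of \<open>\<phi>\<^sub>z\<close> is zero by the scalar
  equation; at \<open>z = -(2n+1)\<close> it is the limit of the zero coefficients at the nearby points.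
\<close>

lemma hermite_svep:
  assumes p: "1 \<le> p" and T: "T \<subseteq> maximal_hermite_operator p" "single_valued T"
  shows "has_svep p T"
  unfolding has_svep_def
proof (intro allI impI ballI)
  fix U \<phi> z
  assume *: "open U \<and> U \<noteq> {} \<and> analytic_Lp p \<phi> U \<and>
        (\<forall>z\<in>U. \<phi> z \<in> Domain T \<and> op_apply T (\<phi> z) - z *\<^sub>a \<phi> z = 0)" and z: "z \<in> U"
  have eq: "(- (2 * of_nat n + 1) - w) * hermite_coeff (\<phi> w) n = 0" if "w \<in> U" for w n
    using resolvent_hermite_coeff[OF p T, of "\<phi> w" w 0 n] * that by (simp add: hermite_coeff_zero)
  show "\<phi> z = 0"
  proof (rule hermite_complete[OF p])
    show "\<phi> z \<in> Lp p" using * z by (simp add: analytic_Lp_def)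
    fix n
    show "hermite_coeff (\<phi> z) n = 0"
    proof (cases "z = - (2 * of_nat n + 1)")
      case False
      then show ?thesis using eq[OF z, of n] by simp
    next
      case True
      have "\<forall>\<^sub>F w in at z. w \<in> U - {z}"
        using * z by (intro eventually_at_in_open) auto
      then have "\<forall>\<^sub>F w in at z. hermite_coeff (\<phi> w) n = 0"
      proof eventually_elim
        case (elim w)
        then show ?case using eq[of w n] True by auto
      qed
      then have "((\<lambda>w. hermite_coeff (\<phi> w) n) \<longlongrightarrow> 0) (at z)" by (rule tendsto_eventually)
      then show ?thesis
        using analytic_hermite_coeff_tendsto[OF p _ z, of \<phi> n] * tendsto_unique[of "at z"] by (metis trivial_limit_at)
    qed
  qed
qed

definition hermite_spectrum :: "(real \<Rightarrow> complex) \<Rightarrow> complex set" where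
  "hermite_spectrum f = {- (2 * of_nat n + 1) | n. hermite_transform f n \<noteq> 0}"

lemma closed_hermite_spectrum: "closed (hermite_spectrum f)"
  by (rule closed_subset_Ints) (auto simp: hermite_spectrum_def)

text \<open>
  The coefficients that a solution of \<open>(T - z) \<phi>\<^sub>z = f\<close> must have. If \<open>\<F>f(n) = 0\<close> and
  \<open>z = -(2n+1)\<close>, the value is \<open>0 / 0 = 0\<close>, which is the choice that keeps the family analytic there.
\<close>

definition resolvent_coeff :: "(real \<Rightarrow> complex) \<Rightarrow> complex \<Rightarrow> nat \<Rightarrow> complex" where
  "resolvent_coeff f z n = hermite_transform f n / (- (2 * of_nat n + 1) - z)"

text \<open>
  The eigenvalues with \<open>\<F>f(n) \<noteq> 0\<close> stay away from a whole neighbourhood of \<open>z\<close>, uniformly in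
  \<open>n\<close>; this is what makes the resolvent coefficients rapidly decreasing, locally uniformly in \<open>z\<close>.
\<close>

lemma hermite_spectrum_gap:
  assumes "z \<notin> hermite_spectrum f"
  obtains \<delta> where "\<delta> > 0" "\<And>n w. hermite_transform f n \<noteq> 0 \<Longrightarrow> dist w z < \<delta> \<Longrightarrow> \<delta> \<le> norm (- (2 * of_nat n + 1) - w)"
proof -
  have "open (- hermite_spectrum f)" using closed_hermite_spectrum by (simp add: open_Compl)
  then obtain e where e: "e > 0" "ball z e \<subseteq> - hermite_spectrum f"
    using assms openE by blast
  have "e / 2 \<le> norm (- (2 * of_nat n + 1) - w)"
    if "hermite_transform f n \<noteq> 0" "dist w z < e / 2" for n w
  proof -
    have "- (2 * of_nat n + 1) \<notin> ball z e" using e(2) that(1) by (auto simp: hermite_spectrum_def)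
    then have "e \<le> dist z (- (2 * of_nat n + 1))" by simp
    also have "\<dots> \<le> dist z w + dist w (- (2 * of_nat n + 1))" by (rule dist_triangle)
    finally have "e / 2 \<le> dist (- (2 * of_nat n + 1)) w" using that(2) by (simp add: dist_commute)
    then show ?thesis by (simp add: dist_norm)
  qed
  then show ?thesis using e(1) by (intro that[of "e / 2"]) auto
qed

lemma resolvent_coeff_rapidly_decreasing:
  assumes f: "f \<in> schwartz_space" and z: "z \<notin> hermite_spectrum f"
  shows "rapidly_decreasing (resolvent_coeff f z)"
    and "rapidly_decreasing (\<lambda>n. resolvent_coeff f z n / (- (2 * of_nat n + 1) - z))"
proof -
  obtain \<delta> where \<delta>: "\<delta> > 0" "\<And>n w. hermite_transform f n \<noteq> 0 \<Longrightarrow> dist w z < \<delta> \<Longrightarrow> \<delta> \<le> norm (- (2 * of_nat n + 1) - w)"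
    using hermite_spectrum_gap[OF z] by metis
  have inv: "inverse (norm (- (2 * of_nat n + 1) - z)) \<le> inverse \<delta>" if "hermite_transform f n \<noteq> 0" for n
    using \<delta>(1) \<delta>(2)[OF that, of z] by (intro le_imp_inverse_le) auto
  show 1: "rapidly_decreasing (resolvent_coeff f z)"
  proof (rule rapidly_decreasing_mult[OF hermite_transform_rapidly_decreasing[OF f], of _ "inverse \<delta>" 0])
    fix n show "norm (resolvent_coeff f z n) \<le> inverse \<delta> * norm (hermite_transform f n) * (real n + 1) ^ 0"
    proof (cases "hermite_transform f n = 0")
      case False
      have "norm (resolvent_coeff f z n) = inverse (norm (- (2 * of_nat n + 1) - z)) * norm (hermite_transform f n)"
        unfolding resolvent_coeff_def norm_divide by (rule trans[OF divide_inverse mult.commute])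
      then show ?thesis using mult_right_mono[OF inv[OF False], of "norm (hermite_transform f n)"] by simp
    qed (simp add: resolvent_coeff_def)
  qed (use \<delta>(1) in simp)
  show "rapidly_decreasing (\<lambda>n. resolvent_coeff f z n / (- (2 * of_nat n + 1) - z))"
  proof (rule rapidly_decreasing_mult[OF 1, of _ "inverse \<delta>" 0])
    fix n show "norm (resolvent_coeff f z n / (- (2 * of_nat n + 1) - z)) \<le> inverse \<delta> * norm (resolvent_coeff f z n) * (real n + 1) ^ 0"
    proof (cases "hermite_transform f n = 0")
      case False
      have "norm (resolvent_coeff f z n / (- (2 * of_nat n + 1) - z)) =
          inverse (norm (- (2 * of_nat n + 1) - z)) * norm (resolvent_coeff f z n)"
        unfolding norm_divide by (rule trans[OF divide_inverse mult.commute])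
      then show ?thesis using mult_right_mono[OF inv[OF False], of "norm (resolvent_coeff f z n)"] by simp
    qed (simp add: resolvent_coeff_def)
  qed (use \<delta>(1) in simp)
qed

definition schwartz_resolvent :: "(real \<Rightarrow> complex) \<Rightarrow> complex \<Rightarrow> aefun" where
  "schwartz_resolvent f z = aeclass (hermite_series (resolvent_coeff f z))"

lemma hermite_series_Lp_norm_le:
  assumes "1 \<le> p" "rapidly_decreasing c"
  shows "Lp_norm p (aeclass (hermite_series c)) \<le> pi * (\<Sum>n. norm (c n) * hermite_weight n)"
  by (rule Lp_norm_decay_le[OF assms(1) hermite_series_decay[OF summable_hermite_weight[OF assms(2)]]])

text \<open>
  With \<open>\<mu>\<^sub>n = -(2n+1)\<close>, the error of the difference quotient of \<open>1 / (\<mu>\<^sub>n - z)\<close> is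
  \<open>(w - z) / ((\<mu>\<^sub>n - w) (\<mu>\<^sub>n - z)\<^sup>2)\<close>. So the error of the difference quotient of the resolvent is
  a Hermite series whose coefficients are at most \<open>|w - z| |\<F>f(n)| / \<delta>\<^sup>3\<close>.
\<close>

lemma schwartz_resolvent_analytic:
  assumes p: "1 \<le> p" and f: "f \<in> schwartz_space" and L: "\<And>g. g \<in> schwartz_space \<Longrightarrow> aeclass g \<in> Lp p"
  shows "analytic_Lp p (schwartz_resolvent f) (- hermite_spectrum f)"
  unfolding analytic_Lp_def
proof (intro conjI ballI)
  fix z assume "z \<in> - hermite_spectrum f"
  then have z: "z \<notin> hermite_spectrum f" by simp
  note rz = resolvent_coeff_rapidly_decreasing[OF f z]
  show "schwartz_resolvent f z \<in> Lp p"
    unfolding schwartz_resolvent_def by (intro L hermite_series_schwartz rz)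
  let ?\<mu> = "\<lambda>n. - (2 * of_nat n + 1) :: complex"
  let ?c = "hermite_transform f"
  let ?d = "\<lambda>n. resolvent_coeff f z n / (?\<mu> n - z)"
  let ?D = "aeclass (hermite_series ?d)"
  obtain \<delta> where \<delta>: "\<delta> > 0" "\<And>n w. ?c n \<noteq> 0 \<Longrightarrow> dist w z < \<delta> \<Longrightarrow> \<delta> \<le> norm (?\<mu> n - w)"
    using hermite_spectrum_gap[OF z] by metis
  let ?M = "pi * inverse \<delta> ^ 3 * (\<Sum>n. norm (?c n) * hermite_weight n)"
  have sc: "summable (\<lambda>n. norm (?c n) * hermite_weight n)"
    by (intro summable_hermite_weight hermite_transform_rapidly_decreasing f)
  have le: "Lp_norm p (inverse (w - z) *\<^sub>a (schwartz_resolvent f w - schwartz_resolvent f z) - ?D)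
      \<le> norm (w - z) * ?M" if w: "dist w z < \<delta>" "w \<noteq> z" for w
  proof -
    have w': "w \<notin> hermite_spectrum f"
    proof
      assume "w \<in> hermite_spectrum f"
      then obtain n where "?c n \<noteq> 0" "w = ?\<mu> n" by (auto simp: hermite_spectrum_def)
      then show False using \<delta>(1) \<delta>(2)[of n w] w by simp
    qed
    note rw = resolvent_coeff_rapidly_decreasing[OF f w']
    let ?e = "\<lambda>n. inverse (w - z) * (resolvent_coeff f w n - resolvent_coeff f z n) - ?d n"
    have e: "norm (?e n) \<le> norm (w - z) * inverse \<delta> ^ 3 * norm (?c n)" for n
    proof (cases "?c n = 0")
      case False
      define a where "a = ?\<mu> n - w"
      define b where "b = ?\<mu> n - z"
      have ab: "\<delta> \<le> norm a" "\<delta> \<le> norm b"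
        using \<delta>(2)[OF False w(1)] \<delta>(2)[OF False, of z] \<delta>(1) by (auto simp: a_def b_def)
      then have ab0: "a \<noteq> 0" "b \<noteq> 0" using \<delta>(1) by auto
      have cancel: "inverse k * (k * x) = x" if "k \<noteq> 0" for k x :: complex
        using that by simp
      have wz: "w - z = b - a" "b - a \<noteq> 0" using w(2) by (auto simp: a_def b_def)
      have "?e n = inverse (b - a) * (?c n / a - ?c n / b) - ?c n / b / b"
        unfolding resolvent_coeff_def a_def[symmetric] b_def[symmetric] wz(1) ..
      also have "?c n / a - ?c n / b = (b - a) * (?c n / (a * b))"
        using ab0 by (simp add: field_simps)
      also have "inverse (b - a) * \<dots> = ?c n / (a * b)"
        by (rule cancel[OF wz(2)])
      also have "\<dots> - ?c n / b / b = (w - z) * ?c n * (inverse a * inverse b * inverse b)"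
        unfolding wz(1) using ab0 by (simp add: field_simps)
      finally have "norm (?e n) = norm (w - z) * norm (?c n) * (inverse (norm a) * inverse (norm b) * inverse (norm b))"
        by (simp add: norm_mult norm_inverse)
      also have "\<dots> \<le> norm (w - z) * norm (?c n) * (inverse \<delta> * inverse \<delta> * inverse \<delta>)"
        using ab \<delta>(1) by (intro mult_left_mono mult_mono le_imp_inverse_le) auto
      finally show ?thesis by (simp add: power3_eq_cube mult_ac)
    qed (simp add: resolvent_coeff_def)
    have re: "rapidly_decreasing ?e"
      by (rule rapidly_decreasing_mult[OF hermite_transform_rapidly_decreasing[OF f],
            of _ "norm (w - z) * inverse \<delta> ^ 3" 0]) (use e \<delta>(1) in auto)
    note bm = schwartz_borel[OF hermite_series_schwartz]
    have rd: "rapidly_decreasing (\<lambda>n. resolvent_coeff f w n - resolvent_coeff f z n)"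
    proof -
      have "rapidly_decreasing (\<lambda>n. (-1) * resolvent_coeff f z n)"
        by (rule rapidly_decreasing_mult[OF rz(1), of _ 1 0]) auto
      from rapidly_decreasing_add[OF rw(1) this] show ?thesis by simp
    qed
    have rk: "rapidly_decreasing (\<lambda>n. inverse (w - z) * (resolvent_coeff f w n - resolvent_coeff f z n))"
      by (rule rapidly_decreasing_mult[OF rd, of _ "norm (inverse (w - z))" 0]) (auto simp: norm_mult)
    have 1: "inverse (w - z) *\<^sub>a (schwartz_resolvent f w - schwartz_resolvent f z) - ?D =
        aeclass (\<lambda>t. inverse (w - z) * (hermite_series (resolvent_coeff f w) t - hermite_series (resolvent_coeff f z) t)
          - hermite_series ?d t)"
    proof -
      let ?A = "hermite_series (resolvent_coeff f w)" and ?B = "hermite_series (resolvent_coeff f z)"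
      have [measurable]: "?A \<in> borel_measurable borel" "?B \<in> borel_measurable borel"
        "hermite_series ?d \<in> borel_measurable borel"
        by (rule bm[OF rw(1)], rule bm[OF rz(1)], rule bm[OF rz(2)])
      have 1: "aeclass ?A - aeclass ?B = aeclass (\<lambda>t. ?A t - ?B t)"
        by (rule aeclass_diff) measurable
      have 2: "inverse (w - z) *\<^sub>a aeclass (\<lambda>t. ?A t - ?B t) = aeclass (\<lambda>t. inverse (w - z) * (?A t - ?B t))"
        by (rule aeclass_scale) measurable
      show ?thesis unfolding schwartz_resolvent_def 1 2 by (rule aeclass_diff) measurable
    qed
    have 2: "inverse (w - z) * (hermite_series (resolvent_coeff f w) t - hermite_series (resolvent_coeff f z) t)
          - hermite_series ?d t = hermite_series ?e t" for t
      using hermite_series_diff[OF rk rz(2), of t] hermite_series_cmult[OF rd, of "inverse (w - z)" t]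
        hermite_series_diff[OF rw(1) rz(1), of t] by (simp only:)
    have "Lp_norm p (inverse (w - z) *\<^sub>a (schwartz_resolvent f w - schwartz_resolvent f z) - ?D)
        \<le> pi * (\<Sum>n. norm (?e n) * hermite_weight n)"
      unfolding 1 2 by (rule hermite_series_Lp_norm_le[OF p re])
    also have "\<dots> \<le> pi * (\<Sum>n. norm (w - z) * inverse \<delta> ^ 3 * (norm (?c n) * hermite_weight n))"
    proof (intro mult_left_mono suminf_le)
      show "norm (?e n) * hermite_weight n \<le> norm (w - z) * inverse \<delta> ^ 3 * (norm (?c n) * hermite_weight n)" for n
        using mult_right_mono[OF e hermite_weight_nonneg, of n n] by (simp only: mult.assoc)
      show "summable (\<lambda>n. norm (?e n) * hermite_weight n)" by (rule summable_hermite_weight[OF re])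
      show "summable (\<lambda>n. norm (w - z) * inverse \<delta> ^ 3 * (norm (?c n) * hermite_weight n))"
        by (rule summable_mult[OF sc])
    qed simp
    also have "\<dots> = norm (w - z) * ?M" unfolding suminf_mult[OF sc] by (simp only: mult_ac)
    finally show ?thesis .
  qed
  show "\<exists>d\<in>Lp p. ((\<lambda>w. Lp_norm p (inverse (w - z) *\<^sub>a (schwartz_resolvent f w - schwartz_resolvent f z) - d))
      \<longlongrightarrow> 0) (at z)"
  proof (rule bexI)
    show "?D \<in> Lp p" by (intro L hermite_series_schwartz rz)
    show "((\<lambda>w. Lp_norm p (inverse (w - z) *\<^sub>a (schwartz_resolvent f w - schwartz_resolvent f z) - ?D)) \<longlongrightarrow> 0) (at z)"
    proof (rule Lim_null_comparison)
      have "((\<lambda>w. norm (w - z) * ?M) \<longlongrightarrow> norm (z - z) * ?M) (at z)" by (intro tendsto_intros)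
      then show "((\<lambda>w. norm (w - z) * ?M) \<longlongrightarrow> 0) (at z)" by simp
      show "\<forall>\<^sub>F w in at z. norm (Lp_norm p (inverse (w - z) *\<^sub>a (schwartz_resolvent f w - schwartz_resolvent f z) - ?D))
          \<le> norm (w - z) * ?M"
        unfolding eventually_at
      proof (intro exI[of _ \<delta>] conjI ballI impI \<delta>(1))
        fix w assume "w \<noteq> z \<and> dist w z < \<delta>"
        moreover have "Lp_norm p v \<ge> 0" for v by (simp add: Lp_norm.rep_eq)
        ultimately show "norm (Lp_norm p (inverse (w - z) *\<^sub>a (schwartz_resolvent f w - schwartz_resolvent f z) - ?D))
          \<le> norm (w - z) * ?M" using le[of w] by simp
      qed
    qed
  qed
qed

text \<open>
  The series is a Schwartz function, so it is in the domain of every extension of the Hermite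
  operator, and both sides of the equation are classes of Schwartz functions with equal coefficients.
\<close>

lemma hermite_operator_resolvent:
  assumes T: "hermite_operator \<subseteq> T" "single_valued T"
    and f: "f \<in> schwartz_space" and z: "z \<notin> hermite_spectrum f"
  shows "schwartz_resolvent f z \<in> Domain T"
    and "op_apply T (schwartz_resolvent f z) - z *\<^sub>a schwartz_resolvent f z = aeclass f"
proof -
  let ?g = "hermite_series (resolvent_coeff f z)"
  note rz = resolvent_coeff_rapidly_decreasing(1)[OF f z]
  have g: "?g \<in> schwartz_space" by (rule hermite_series_schwartz[OF rz])
  have in_T: "(schwartz_resolvent f z, aeclass (hermite_diff ?g)) \<in> T"
    using T(1) g by (auto simp: schwartz_resolvent_def hermite_operator_def)
  then show "schwartz_resolvent f z \<in> Domain T" by blast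
  note Tg = schwartz_hermite_diff[OF g] and zg = schwartz_cmult[OF g, of z]
  have "op_apply T (schwartz_resolvent f z) - z *\<^sub>a schwartz_resolvent f z =
      aeclass (\<lambda>t. hermite_diff ?g t - z * ?g t)"
    unfolding op_apply_eqI[OF T(2) in_T] unfolding schwartz_resolvent_def
    using schwartz_borel[OF g] schwartz_borel[OF Tg] schwartz_borel[OF zg]
    by (simp add: aeclass_diff aeclass_scale)
  also have "\<dots> = aeclass f"
  proof (rule schwartz_class_eqI[OF schwartz_diff[OF Tg zg] f])
    fix n
    have "hermite_transform (\<lambda>t. hermite_diff ?g t - z * ?g t) n = (- (2 * of_nat n + 1) - z) * resolvent_coeff f z n"
      unfolding hermite_transform_diff[OF Tg zg] hermite_transform_hermite_diff[OF g] hermite_transform_cmult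
        hermite_transform_series[OF rz] by (rule left_diff_distrib[symmetric])
    also have "\<dots> = hermite_transform f n"
    proof (cases "hermite_transform f n = 0")
      case False
      then have "- (2 * of_nat n + 1) - z \<noteq> 0" using z by (auto simp: hermite_spectrum_def)
      then show ?thesis by (simp add: resolvent_coeff_def)
    qed (simp add: resolvent_coeff_def)
    finally show "hermite_transform (\<lambda>t. hermite_diff ?g t - z * ?g t) n = hermite_transform f n" .
  qed
  finally show "op_apply T (schwartz_resolvent f z) - z *\<^sub>a schwartz_resolvent f z = aeclass f" .
qed

lemma hermite_local_spectrum:
  assumes p: "1 \<le> p" and T: "linear_operator p T" "hermite_operator \<subseteq> T" "T \<subseteq> maximal_hermite_operator p"
    and f: "f \<in> schwartz_space"
  shows "local_spectrum p T (aeclass f) = hermite_spectrum f"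
proof -
  have sv: "single_valued T" using T(1) by (simp add: linear_operator_def)
  have L: "aeclass g \<in> Lp p" if "g \<in> schwartz_space" for g
    using T(1,2) that by (auto simp: linear_operator_def hermite_operator_def)
  have "local_resolvent_set p T (aeclass f) = - hermite_spectrum f"
  proof (intro equalityI subsetI)
    fix z assume "z \<in> local_resolvent_set p T (aeclass f)"
    then obtain U \<phi> where "z \<in> U" and U: "\<forall>z\<in>U. \<phi> z \<in> Domain T \<and> op_apply T (\<phi> z) - z *\<^sub>a \<phi> z = aeclass f"
      unfolding local_resolvent_set_def mem_Collect_eq by (elim exE conjE)
    then have \<phi>: "\<phi> z \<in> Domain T" "op_apply T (\<phi> z) - z *\<^sub>a \<phi> z = aeclass f"
      using bspec[OF U] by simp_all
    show "z \<in> - hermite_spectrum f"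
    proof
      assume "z \<in> hermite_spectrum f"
      then obtain n where n: "z = - (2 * of_nat n + 1)" "hermite_transform f n \<noteq> 0"
        by (auto simp: hermite_spectrum_def)
      have "hermite_transform f n = 0"
        using resolvent_hermite_coeff[OF p T(3) sv \<phi>, of n] unfolding n(1)
        by (simp add: hermite_coeff_aeclass schwartz_borel[OF f])
      with n(2) show False by simp
    qed
  next
    fix z assume "z \<in> - hermite_spectrum f"
    then show "z \<in> local_resolvent_set p T (aeclass f)"
      unfolding local_resolvent_set_def mem_Collect_eq
      using closed_hermite_spectrum[of f] schwartz_resolvent_analytic[OF p f L]
        hermite_operator_resolvent[OF T(2) sv f]
      by (intro exI[of _ "- hermite_spectrum f"] exI[of _ "schwartz_resolvent f"]) (auto simp: open_Compl)
  qed
  then show ?thesis by (auto simp: local_spectrum_def)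
qed

section \<open>The growth of the powers\<close>

lemma hermite_operator_power:
  assumes "hermite_operator \<subseteq> T" "f \<in> schwartz_space"
  shows "(aeclass f, aeclass ((hermite_diff ^^ k) f)) \<in> T ^^ k"
proof (induction k)
  case (Suc k)
  have "(aeclass ((hermite_diff ^^ k) f), aeclass (hermite_diff ((hermite_diff ^^ k) f))) \<in> T"
    using assms(1) schwartz_hermite_diff_power[OF assms(2), of k] by (auto simp: hermite_operator_def)
  with Suc show ?case by (auto intro: relpow_Suc_I simp del: relpow.simps)
qed simp

lemma root_of_geometric_tendsto:
  fixes c r :: real
  assumes "c > 0" "r \<ge> 0"
  shows "(\<lambda>k. (c * r ^ k) powr (1 / real k)) \<longlonglongrightarrow> r"
proof -
  have "(\<lambda>k. c powr (1 / real k) * r) \<longlonglongrightarrow> c powr 0 * r"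
    using assms(1) by (intro tendsto_intros lim_1_over_n) auto
  moreover have "\<forall>\<^sub>F k in sequentially. c powr (1 / real k) * r = (c * r ^ k) powr (1 / real k)"
    using eventually_gt_at_top[of 0]
  proof eventually_elim
    case (elim k)
    have "(r ^ k) powr (1 / real k) = r"
    proof (cases "r = 0")
      case False
      then show ?thesis using assms elim by (simp add: powr_realpow[symmetric] powr_powr)
    qed (use elim in simp)
    then show ?case by (simp add: powr_mult)
  qed
  ultimately show ?thesis using assms(1) by (simp add: Lim_transform_eventually)
qed

lemma hermite_power_norm_lower:
  assumes p: "1 \<le> p" and f: "f \<in> schwartz_space" and L: "aeclass ((hermite_diff ^^ k) f) \<in> Lp p"
  shows "norm (hermite_transform f n) * (2 * real n + 1) ^ k
    \<le> hermite_weight n * (pi + 1) * Lp_norm p (aeclass ((hermite_diff ^^ k) f))"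
  using hermite_coeff_bound[OF p L, of n]
  unfolding hermite_coeff_aeclass[OF schwartz_borel[OF schwartz_hermite_diff_power[OF f]]]
    hermite_transform_hermite_diff_power[OF f] norm_mult norm_power norm_hermite_eigenvalue
  by (simp only: mult.commute)

text \<open>
  The function \<open>T\<^sup>k f\<close> is the sum of its Hermite series, whose coefficients are
  \<open>(-(2n+1))\<^sup>k \<F>f(n)\<close>; only indices with \<open>2n+1 \<le> r\<close> contribute.
\<close>

lemma hermite_power_norm_upper:
  assumes p: "1 \<le> p" and f: "f \<in> schwartz_space"
    and r: "\<And>n. hermite_transform f n \<noteq> 0 \<Longrightarrow> 2 * real n + 1 \<le> r"
  shows "Lp_norm p (aeclass ((hermite_diff ^^ k) f)) \<le> pi * (\<Sum>n. norm (hermite_transform f n) * hermite_weight n) * r ^ k"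
proof -
  let ?g = "(hermite_diff ^^ k) f" and ?c = "hermite_transform f"
  have g: "?g \<in> schwartz_space" by (rule schwartz_hermite_diff_power[OF f])
  note rg = hermite_transform_rapidly_decreasing[OF g]
  have sc: "summable (\<lambda>n. norm (?c n) * hermite_weight n)"
    by (intro summable_hermite_weight hermite_transform_rapidly_decreasing f)
  have "aeclass ?g = aeclass (hermite_series (hermite_transform ?g))"
    by (intro schwartz_class_eqI g hermite_series_schwartz rg) (simp add: hermite_transform_series[OF rg])
  then have "Lp_norm p (aeclass ?g) \<le> pi * (\<Sum>n. norm (hermite_transform ?g n) * hermite_weight n)"
    using hermite_series_Lp_norm_le[OF p rg] by simp
  also have "\<dots> \<le> pi * (\<Sum>n. r ^ k * (norm (?c n) * hermite_weight n))"
  proof (intro mult_left_mono suminf_le)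
    fix n
    have "norm (hermite_transform ?g n) = (2 * real n + 1) ^ k * norm (?c n)"
      unfolding hermite_transform_hermite_diff_power[OF f] norm_mult norm_power norm_hermite_eigenvalue ..
    also have "\<dots> \<le> r ^ k * norm (?c n)"
      using r[of n] by (cases "?c n = 0") (auto intro!: mult_right_mono power_mono)
    finally show "norm (hermite_transform ?g n) * hermite_weight n \<le> r ^ k * (norm (?c n) * hermite_weight n)"
      using mult_right_mono[OF _ hermite_weight_nonneg[of n]] by (simp add: mult.assoc[symmetric])
  qed (use summable_hermite_weight[OF rg] summable_mult[OF sc] in auto)
  also have "\<dots> = pi * (\<Sum>n. norm (?c n) * hermite_weight n) * r ^ k"
    by (simp add: suminf_mult[OF sc])
  finally show ?thesis .
qed

text \<open>
  Lower bounds come from each \<open>n\<close> with \<open>\<F>f(n) \<noteq> 0\<close> separately, upper bounds only matter if the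
  supremum is a finite number \<open>r\<close>. In both cases the constants in front of the geometric sequence
  disappear when \<open>k\<close>-th roots are taken.
\<close>

lemma hermite_spectral_radius:
  assumes p: "1 \<le> p" and f: "f \<in> schwartz_space" and L: "\<And>g. g \<in> schwartz_space \<Longrightarrow> aeclass g \<in> Lp p"
  shows "(\<lambda>k. ennreal (Lp_norm p (aeclass ((hermite_diff ^^ k) f)) powr (1 / real k)))
    \<longlonglongrightarrow> (SUP z\<in>hermite_spectrum f. ennreal (cmod z))"
proof -
  define a where "a k = Lp_norm p (aeclass ((hermite_diff ^^ k) f))" for k
  have a0: "a k \<ge> 0" for k by (simp add: a_def Lp_norm.rep_eq)
  let ?c = "hermite_transform f"
  let ?S = "SUP z\<in>hermite_spectrum f. ennreal (cmod z)"
  have "(\<lambda>k. ennreal (a k powr (1 / real k))) \<longlonglongrightarrow> ?S"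
  proof (rule order_tendstoI)
    fix x assume "x < ?S"
    then obtain z where "z \<in> hermite_spectrum f" "x < ennreal (cmod z)" by (auto simp: less_SUP_iff)
    then obtain n where n: "?c n \<noteq> 0" "x < ennreal (2 * real n + 1)"
      unfolding hermite_spectrum_def mem_Collect_eq by (metis norm_hermite_eigenvalue)
    define W where "W = hermite_weight n * (pi + 1)"
    have le: "norm (?c n) * (2 * real n + 1) ^ k \<le> W * a k" for k
      unfolding W_def a_def by (intro hermite_power_norm_lower p f L schwartz_hermite_diff_power)
    have "W > 0"
    proof (rule ccontr)
      assume "\<not> W > 0"
      then have "W * a 0 \<le> 0" using a0[of 0] by (simp add: mult_nonpos_nonneg)
      moreover have "0 < norm (?c n)" using n(1) by simp
      ultimately show False using le[of 0] by (simp del: zero_less_norm_iff)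
    qed
    define c where "c = norm (?c n) / W"
    have c: "c > 0" using n(1) \<open>W > 0\<close> by (simp add: c_def)
    have "(\<lambda>k. (c * (2 * real n + 1) ^ k) powr (1 / real k)) \<longlonglongrightarrow> 2 * real n + 1"
      by (intro root_of_geometric_tendsto c) simp
    then have "(\<lambda>k. ennreal ((c * (2 * real n + 1) ^ k) powr (1 / real k))) \<longlonglongrightarrow> ennreal (2 * real n + 1)"
      by (rule tendsto_ennrealI)
    from order_tendstoD(1)[OF this n(2)]
    show "\<forall>\<^sub>F k in sequentially. x < ennreal (a k powr (1 / real k))"
    proof eventually_elim
      case (elim k)
      have "c * (2 * real n + 1) ^ k \<le> a k"
        using le[of k] \<open>W > 0\<close> by (simp add: c_def divide_le_eq mult.commute)
      then have "ennreal ((c * (2 * real n + 1) ^ k) powr (1 / real k)) \<le> ennreal (a k powr (1 / real k))"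
        using c by (intro ennreal_leI powr_mono2) auto
      with elim show ?case by (rule less_le_trans)
    qed
  next
    fix x assume x: "?S < x"
    define r where "r = enn2real ?S"
    have "?S < top" using x top_greatest by (rule less_le_trans)
    then have S: "?S = ennreal r" unfolding r_def by (rule ennreal_enn2real[symmetric])
    have r: "2 * real n + 1 \<le> r" if "?c n \<noteq> 0" for n
    proof -
      have "ennreal (cmod (- (2 * of_nat n + 1))) \<le> ?S"
        using that by (intro SUP_upper) (auto simp: hermite_spectrum_def)
      moreover have "0 \<le> r" by (simp add: r_def)
      ultimately show ?thesis unfolding norm_hermite_eigenvalue S using ennreal_le_iff by blast
    qed
    \<comment> \<open>Adding \<open>1\<close> keeps \<open>M\<close> positive when all coefficients vanish; then \<open>r = 0\<close>.\<close>
    define M where "M = pi * (\<Sum>n. norm (?c n) * hermite_weight n) + 1"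
    have "0 \<le> (\<Sum>n. norm (?c n) * hermite_weight n)"
      by (intro suminf_nonneg summable_hermite_weight hermite_transform_rapidly_decreasing f)
        (simp add: hermite_weight_nonneg)
    then have M: "M > 0" by (simp add: M_def add_nonneg_pos)
    have r0: "r \<ge> 0" by (simp add: r_def)
    have le: "a k \<le> M * r ^ k" for k
    proof -
      have "a k \<le> pi * (\<Sum>n. norm (?c n) * hermite_weight n) * r ^ k"
        unfolding a_def by (intro hermite_power_norm_upper p f r)
      also have "\<dots> \<le> M * r ^ k" using r0 by (intro mult_right_mono) (auto simp: M_def)
      finally show ?thesis .
    qed
    have "(\<lambda>k. ennreal ((M * r ^ k) powr (1 / real k))) \<longlonglongrightarrow> ?S"
      unfolding S by (intro tendsto_ennrealI root_of_geometric_tendsto M r0)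
    from order_tendstoD(2)[OF this x]
    show "\<forall>\<^sub>F k in sequentially. ennreal (a k powr (1 / real k)) < x"
    proof eventually_elim
      case (elim k)
      have "ennreal (a k powr (1 / real k)) \<le> ennreal ((M * r ^ k) powr (1 / real k))"
        using le[of k] a0[of k] by (intro ennreal_leI powr_mono2) auto
      then show ?case using elim by (rule le_less_trans)
    qed
  qed
  then show ?thesis by (simp only: a_def)
qed

theorem theorem3p5:
  fixes p :: ennreal and T\<^sub>e :: "(aefun \<times> aefun) set"
  assumes "1 \<le> p"
    and "linear_operator p T\<^sub>e"
    and "hermite_operator \<subseteq> T\<^sub>e"
    and "T\<^sub>e \<subseteq> maximal_hermite_operator p"
  shows "has_svep p T\<^sub>e \<and>
    (\<forall>f\<in>schwartz_space.
       (\<forall>n. aeclass f \<in> Domain (T\<^sub>e ^^ n)) \<and>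
       (\<lambda>n. ennreal (Lp_norm p (op_apply (T\<^sub>e ^^ n) (aeclass f)) powr (1 / real n)))
         \<longlonglongrightarrow> (SUP z\<in>{- (2 * of_nat n + 1) | n. hermite_transform f n \<noteq> 0}. ennreal (cmod z)) \<and>
       local_spectrum p T\<^sub>e (aeclass f) =
         {- (2 * of_nat n + 1) | n. hermite_transform f n \<noteq> 0} \<and>
       (\<lambda>n. ennreal (Lp_norm p (op_apply (T\<^sub>e ^^ n) (aeclass f)) powr (1 / real n)))
         \<longlonglongrightarrow> (SUP z\<in>local_spectrum p T\<^sub>e (aeclass f). ennreal (cmod z)))"
proof (intro conjI ballI)
  note p = assms(1) and T = assms(2-4)
  have sv: "single_valued T\<^sub>e" using T(1) by (simp add: linear_operator_def)
  show "has_svep p T\<^sub>e" by (rule hermite_svep[OF p T(3) sv])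
  fix f assume f: "f \<in> schwartz_space"
  have L: "aeclass g \<in> Lp p" if "g \<in> schwartz_space" for g
    using T(1,2) that by (auto simp: linear_operator_def hermite_operator_def)
  note pow = hermite_operator_power[OF T(2) f]
  show "\<forall>n. aeclass f \<in> Domain (T\<^sub>e ^^ n)" using pow by blast
  have op: "op_apply (T\<^sub>e ^^ n) (aeclass f) = aeclass ((hermite_diff ^^ n) f)" for n
    by (rule op_apply_eqI[OF single_valued_relpow[OF sv] pow])
  note lim = hermite_spectral_radius[OF p f L]
  show spec: "local_spectrum p T\<^sub>e (aeclass f) = {- (2 * of_nat n + 1) | n. hermite_transform f n \<noteq> 0}"
    using hermite_local_spectrum[OF p T f] by (simp only: hermite_spectrum_def)
  show *: "(\<lambda>n. ennreal (Lp_norm p (op_apply (T\<^sub>e ^^ n) (aeclass f)) powr (1 / real n)))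
      \<longlonglongrightarrow> (SUP z\<in>{- (2 * of_nat n + 1) | n. hermite_transform f n \<noteq> 0}. ennreal (cmod z))"
    using lim unfolding op hermite_spectrum_def .
  show "(\<lambda>n. ennreal (Lp_norm p (op_apply (T\<^sub>e ^^ n) (aeclass f)) powr (1 / real n)))
      \<longlonglongrightarrow> (SUP z\<in>local_spectrum p T\<^sub>e (aeclass f). ennreal (cmod z))"
    using * unfolding spec .
qed

end
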